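(* Let $(\mathcal{A},\mathcal{H},D)$ be a spectral triple, let $A$ be the $C^*$-norm completion of $\mathcal{A}$, let $(A,\widetilde{A},G)$ be a unital noncommutative finite-fold covering, and let $(\widetilde{\mathcal{A}},\widetilde{\mathcal{H}},\widetilde{D})$ be the $(A,\widetilde{A},G)$-lift of $(\mathcal{A},\mathcal{H},D)$. Let $\rho: G\to GL(n,\mathbb{C})$ be a linear representation, and write $gx=\rho(g)x$ for $g\in G$, $x\in\mathbb{C}^n$. Let $\widetilde{\mathcal{E}}=\widetilde{\mathcal{A}}\otimes\mathbb{C}^n\cong\widetilde{\mathcal{A}}^n$ be the free $\widetilde{\mathcal{A}}$-module, with the action of $G$ given by $g(\widetilde{a}\otimes x)=g\widetilde{a}\otimes gx$, and let $$\mathcal{E}=\widetilde{\mathcal{E}}^G=\{\widetilde{\xi}\in\widetilde{\mathcal{E}} : g\widetilde{\xi}=\widetilde{\xi}\ \text{ for all } g\in G\}.$$ Let $e\in\operatorname{End}_{\mathcal{A}}(\widetilde{\mathcal{E}})$ be the idempotent $e\widetilde{\xi}=\frac{1}{|G|}\sum_{g\in G}g\widetilde{\xi}$, so that $\mathcal{E}=e\widetilde{\mathcal{E}}$. Let $\widetilde{\nabla}:\widetilde{\mathcal{E}}\to\widetilde{\mathcal{E}}\otimes_{\widetilde{\mathcal{A}}}\Omega^1_{\widetilde{D}}$ be the trivial flat connection, and let $$\nabla':\widetilde{\mathcal{E}}\to\widetilde{\mathcal{E}}\otimes_{\mathcal{A}}\Omega^1_D$$ be the map obtained from $\widetilde{\nabla}$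 through the identification $\widetilde{\mathcal{E}}\otimes_{\widetilde{\mathcal{A}}}\Omega^1_{\widetilde{D}}=\widetilde{\mathcal{E}}\otimes_{\widetilde{\mathcal{A}}}\widetilde{\mathcal{A}}\otimes_{\mathcal{A}}\Omega^1_D=\widetilde{\mathcal{E}}\otimes_{\mathcal{A}}\Omega^1_D$. Then $\mathcal{E}$ is a finitely generated projective $\mathcal{A}$-module, and the map $$\nabla:\mathcal{E}\to\mathcal{E}\otimes_{\mathcal{A}}\Omega^1_D,\qquad \nabla\xi=(e\otimes 1)\nabla'\xi,$$ is a flat connection on $\mathcal{E}$.
   Context: **Spectral triples.** A (unital) spectral triple $(\mathcal{A},\mathcal{H},D)$ consists of a pre-$C^*$-algebra $\mathcal{A}$ with involution $a\mapsto a^*$, faithfully represented on a Hilbert space $\mathcal{H}$, and a selfadjoint operator $D$ on $\mathcal{H}$ with dense domain $\operatorname{Dom}D$ such that $a(\operatorname{Dom}D)\subseteq\operatorname{Dom}D$ for all $a\in\mathcal{A}$, subject to the usual axioms for spectral triples (in particular each $[D,a]$ is bounded). The $\mathcal{A}$-bimodule $\Omega^1_D\subset B(\mathcal{H})$ is the linear span of the operators $a[D,b]$, $a,b\in\mathcal{A}$, and $d:\mathcal{A}\to\Omega^1_D$ is $d(a)=[D,a]$. It is the degree-one part of Connes' graded differential algebra $\Omega_D=\bigoplus_j\Omega_D^j$ of the spectral triple, with $\Omega^0_D=\mathcal{A}$ and a graded derivation $d$ of degree $1$ satisfying $d^2=0$. **Coverings.** An action of a group $G$ on a $C^*$-algebra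 is involutive if $ga^*=(ga)^*$ for all $a$, $g$, and non-degenerated if for every nontrivial $g\in G$ there is $a$ with $ga\ne a$. Let $A\hookrightarrow\widetilde{A}$ be an injective $*$-homomorphism of unital $C^*$-algebras and suppose there is a non-degenerated involutive action of a finite group $G$ on $\widetilde{A}$ with $A=\widetilde{A}^G=\{a\in\widetilde{A}: ga=a\ \forall g\in G\}$. Then $\widetilde{A}$ is an $A$-Hilbert module with $\langle a,b\rangle_{\widetilde{A}}=\sum_{g\in G}g(a^*b)$. The triple $(A,\widetilde{A},G)$ is a unital noncommutative finite-fold covering if $\widetilde{A}$ is a finitely generated projective $A$-Hilbert module. **Lifts.** Let $\widetilde{\mathcal{H}}=\widetilde{A}\otimes_A\mathcal{H}$ with Hilbert product $(\widetilde{a}\otimes\xi,\widetilde{b}\otimes\eta)_{\widetilde{\mathcal{H}}}=\frac{1}{|G|}\left(\xi,\left(\sum_{g\in G}g(\widetilde{a}^*\widetilde{b})\right)\eta\right)_{\mathcal{H}}$ and the natural representation $\widetilde{A}\to B(\widetilde{\mathcal{H}})$. A spectral triple $(\widetilde{\mathcal{A}},\widetilde{\mathcal{H}},\widetilde{D})$ is an $(A,\widetilde{A},G)$-lift of $(\mathcal{A},\mathcal{H},D)$ if: (a) $\widetilde{A}$ is the $C^*$-norm completion of $\widetilde{\mathcal{A}}$; (b) $\widetilde{D}(1_{\widetilde{A}}\otimes_A\xi)=1_{\widetilde{A}}\otimes_A D\xi$ for all $\xi\in\operatorname{Dom}D$; (c) $\widetilde{D}(g\widetilde{\xi})=g(\widetilde{D}\widetilde{\xi})$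 for all $\widetilde{\xi}\in\operatorname{Dom}\widetilde{D}$, $g\in G$. The following known facts are taken as given: the lift exists and is unique; $G$ acts on $\widetilde{\mathcal{A}}$ by restriction of its action on $\widetilde{A}$; $\widetilde{\mathcal{A}}$ contains $\mathcal{A}$ and is a finitely generated projective $\mathcal{A}$-module; and $\Omega^1_{\widetilde{D}}=\widetilde{\mathcal{A}}\otimes_{\mathcal{A}}\Omega^1_D$ (where $\widetilde{a}\otimes b[D,c]$ corresponds to $\widetilde{a}b[\widetilde{D},c]$ for $\widetilde{a}\in\widetilde{\mathcal{A}}$, $b,c\in\mathcal{A}$). **Connections.** For a finitely generated projective right $\mathcal{A}$-module $\mathcal{E}$, a connection is a linear map $\nabla:\mathcal{E}\to\mathcal{E}\otimes_{\mathcal{A}}\Omega^1_D$ with $\nabla(\xi x)=\nabla(\xi)x+\xi\otimes dx$ for $\xi\in\mathcal{E}$, $x\in\mathcal{A}$. It extends uniquely to a linear map of $\mathcal{E}\otimes_{\mathcal{A}}\Omega_D$ into itself with $\nabla(\xi\otimes\omega)=\nabla(\xi)\omega+\xi\otimes d\omega$ for $\xi\in\mathcal{E}$, $\omega\in\Omega_D$. Its curvature is $F_\nabla=\nabla\circ\nabla|_{\mathcal{E}}:\mathcal{E}\to\mathcal{E}\otimes_{\mathcal{A}}\Omega_D^2$, and $\nabla$ is flat if $F_\nabla=0$. The same definitions apply with $(\widetilde{\mathcal{A}},\widetilde{D})$ in place of $(\mathcal{A},D)$. The trivial flat connection on the free module $\widetilde{\mathcal{E}}=\widetilde{\mathcal{A}}\otimes\mathbb{C}^n$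 is given by $\widetilde{\nabla}\left(\sum_i\widetilde{a}_i\otimes x_i\right)=\sum_i(1\otimes x_i)\otimes[\widetilde{D},\widetilde{a}_i]$, where $x_1,\dots,x_n$ is the standard basis of $\mathbb{C}^n$.
   Formalization: Adds the degree-two identification of two-forms of the lift with the lifted algebra tensored with Ω²_D, since flatness can fail with only the degree-one one; uniqueness of the lift, which fails for non-trivial G, is not assumed: the result is for every lift having these facts. *)

theory Defs
  imports
    "HOL-Analysis.Analysis"
    "HOL-Algebra.Group"
    "HOL-Library.Poly_Mapping"
    "HOL-Library.Set_Algebras"
    "HOL-Computational_Algebra.Group_Closure"
begin

section \<open>Complex Hilbert spaces and unital C*-algebras\<close>

class complex_vector = real_vector +
  fixes scaleC :: "complex \<Rightarrow> 'a \<Rightarrow> 'a"  (infixr \<open>*\<^sub>C\<close> 75)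
  assumes scaleC_add_right: "c *\<^sub>C (x + y) = c *\<^sub>C x + c *\<^sub>C y"
    and scaleC_add_left: "(c + d) *\<^sub>C x = c *\<^sub>C x + d *\<^sub>C x"
    and scaleC_scaleC: "c *\<^sub>C d *\<^sub>C x = (c * d) *\<^sub>C x"
    and scaleR_scaleC: "r *\<^sub>R x = complex_of_real r *\<^sub>C x"

text \<open>The inner product is conjugate-linear in its first argument.  Positivity and
  definiteness are contained in \<open>cinner_norm\<close>.\<close>

class chilbert_space = complex_vector + banach +
  fixes cinner :: "'a \<Rightarrow> 'a \<Rightarrow> complex"
  assumes cinner_commute: "cinner x y = cnj (cinner y x)"
    and cinner_add_right: "cinner x (y + z) = cinner x y + cinner x z"
    and cinner_scaleC_right: "cinner x (c *\<^sub>C y) = c * cinner x y"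
    and cinner_norm: "cinner x x = complex_of_real ((norm x)\<^sup>2)"

class cstar_algebra = complex_vector + real_normed_algebra_1 + banach +
  fixes star :: "'a \<Rightarrow> 'a"
  assumes mult_scaleC_left: "(c *\<^sub>C x) * y = c *\<^sub>C (x * y)"
    and mult_scaleC_right: "x * (c *\<^sub>C y) = c *\<^sub>C (x * y)"
    and norm_scaleC: "norm (c *\<^sub>C x) = norm c * norm x"
    and star_star: "star (star x) = x"
    and star_add: "star (x + y) = star x + star y"
    and star_scaleC: "star (c *\<^sub>C x) = cnj c *\<^sub>C star x"
    and star_mult: "star (x * y) = star y * star x"
    and cstar_identity: "norm (star x * x) = (norm x)\<^sup>2"

section \<open>Modules over a subring of a type, and their tensor products\<close>

text \<open>Rings are subsets \<open>R\<close> of a type with multiplication.  A one-sided module is a pair of a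
  carrier set and an action; right actions take the module element first, left actions the ring
  element first.  Addition is that of the type; for modules whose elements are cosets
  (tensor products, two-forms) it is the elementwise addition of sets from \<open>Set_Algebras\<close>.\<close>

type_synonym ('r, 'm) rmod = "'m set \<times> ('m \<Rightarrow> 'r \<Rightarrow> 'm)"
type_synonym ('r, 'n) lmod = "'n set \<times> ('r \<Rightarrow> 'n \<Rightarrow> 'n)"

definition additive_on :: "'a::plus set \<Rightarrow> ('a \<Rightarrow> 'b::plus) \<Rightarrow> bool" where
  "additive_on S h \<longleftrightarrow> (\<forall>x\<in>S. \<forall>y\<in>S. h (x + y) = h x + h y)"

text \<open>\<open>M\<close> is finitely generated projective: it is a direct summand of some free module \<open>R\<^sup>k\<close>.\<close>

definition free_rmod :: "'r set \<Rightarrow> nat \<Rightarrow> (nat \<Rightarrow> 'r::zero) set" where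
  "free_rmod R k = {v. (\<forall>j<k. v j \<in> R) \<and> (\<forall>j\<ge>k. v j = 0)}"

definition fg_projective :: "'r::ring_1 set \<Rightarrow> ('r, 'm::ab_group_add) rmod \<Rightarrow> bool" where
  "fg_projective R M \<longleftrightarrow> (\<exists>k i p.
     i \<in> fst M \<rightarrow> free_rmod R k \<and>
     (\<forall>x\<in>fst M. \<forall>y\<in>fst M. \<forall>j. i (x + y) j = i x j + i y j) \<and>
     (\<forall>x\<in>fst M. \<forall>r\<in>R. \<forall>j. i (snd M x r) j = i x j * r) \<and>
     p \<in> free_rmod R k \<rightarrow> fst M \<and>
     (\<forall>v\<in>free_rmod R k. \<forall>w\<in>free_rmod R k. p (\<lambda>j. v j + w j) = p v + p w) \<and>
     (\<forall>v\<in>free_rmod R k. \<forall>r\<in>R. p (\<lambda>j. v j * r) = snd M (p v) r) \<and>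
     (\<forall>x\<in>fst M. p (i x) = x))"

text \<open>\<open>M \<otimes>\<^sub>R N\<close> is the free abelian group on \<open>M \<times> N\<close> modulo the balanced biadditive relations.\<close>

definition tensor_rel ::
  "'r set \<Rightarrow> ('r, 'm::plus) rmod \<Rightarrow> ('r, 'n::plus) lmod \<Rightarrow> ('m \<times> 'n \<Rightarrow>\<^sub>0 int) set" where
  "tensor_rel R M N = group_closure
     ({frag_of (m + m', n) - frag_of (m, n) - frag_of (m', n) | m m' n.
         m \<in> fst M \<and> m' \<in> fst M \<and> n \<in> fst N} \<union>
      {frag_of (m, n + n') - frag_of (m, n) - frag_of (m, n') | m n n'.
         m \<in> fst M \<and> n \<in> fst N \<and> n' \<in> fst N} \<union>
      {frag_of (snd M m r, n) - frag_of (m, snd N r n) | m r n.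
         m \<in> fst M \<and> r \<in> R \<and> n \<in> fst N})"

definition tensor ::
  "'r set \<Rightarrow> ('r, 'm::plus) rmod \<Rightarrow> ('r, 'n::plus) lmod \<Rightarrow> ('m \<times> 'n \<Rightarrow>\<^sub>0 int) set set" where
  "tensor R M N = {c +o tensor_rel R M N | c. Poly_Mapping.keys c \<subseteq> fst M \<times> fst N}"

definition tens ::
  "'r set \<Rightarrow> ('r, 'm::plus) rmod \<Rightarrow> ('r, 'n::plus) lmod \<Rightarrow> 'm \<Rightarrow> 'n \<Rightarrow> ('m \<times> 'n \<Rightarrow>\<^sub>0 int) set" where
  "tens R M N m n = frag_of (m, n) +o tensor_rel R M N"

text \<open>The unique additive map \<open>M \<otimes>\<^sub>R N \<rightarrow> K\<close> with \<open>m \<otimes> n \<mapsto> f m n\<close>, for balanced biadditive \<open>f\<close>.\<close>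

definition tensor_lift ::
  "'r set \<Rightarrow> ('r, 'm::plus) rmod \<Rightarrow> ('r, 'n::plus) lmod \<Rightarrow> 'k::plus set \<Rightarrow> ('m \<Rightarrow> 'n \<Rightarrow> 'k)
    \<Rightarrow> ('m \<times> 'n \<Rightarrow>\<^sub>0 int) set \<Rightarrow> 'k" where
  "tensor_lift R M N K f = (THE h. h \<in> tensor R M N \<rightarrow>\<^sub>E K \<and> additive_on (tensor R M N) h \<and>
     (\<forall>m\<in>fst M. \<forall>n\<in>fst N. h (tens R M N m n) = f m n))"

section \<open>Spectral triples\<close>

text \<open>Equality of the graphs of \<open>D\<close> and of its adjoint.\<close>

definition selfadjoint_op :: "'h::chilbert_space set \<Rightarrow> ('h \<Rightarrow> 'h) \<Rightarrow> bool" where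
  "selfadjoint_op V D \<longleftrightarrow>
     0 \<in> V \<and> (\<forall>x\<in>V. \<forall>y\<in>V. x + y \<in> V \<and> D (x + y) = D x + D y) \<and>
     (\<forall>c. \<forall>x\<in>V. c *\<^sub>C x \<in> V \<and> D (c *\<^sub>C x) = c *\<^sub>C D x) \<and>
     closure V = UNIV \<and>
     (\<forall>y z. (y \<in> V \<and> D y = z) \<longleftrightarrow> (\<forall>x\<in>V. cinner (D x) y = cinner x z))"

definition compact_resolvent :: "'h::chilbert_space set \<Rightarrow> ('h \<Rightarrow> 'h) \<Rightarrow> bool" where
  "compact_resolvent V D \<longleftrightarrow> (\<forall>z. z \<notin> \<real> \<longrightarrow>
     (\<exists>S :: 'h \<Rightarrow>\<^sub>L 'h. compact (closure (blinfun_apply S ` cball 0 1)) \<and>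
        (\<forall>x. S x \<in> V \<and> D (S x) - z *\<^sub>C S x = x) \<and>
        (\<forall>x\<in>V. S (D x - z *\<^sub>C x) = x)))"

definition star_subalgebra :: "'a::cstar_algebra set \<Rightarrow> bool" where
  "star_subalgebra \<A> \<longleftrightarrow> 1 \<in> \<A> \<and> (\<forall>a\<in>\<A>. star a \<in> \<A> \<and> (\<forall>c. c *\<^sub>C a \<in> \<A>)) \<and>
     (\<forall>a\<in>\<A>. \<forall>b\<in>\<A>. a + b \<in> \<A> \<and> a * b \<in> \<A>)"

text \<open>The pre-C*-algebra \<open>Alg\<close> is a unital *-subalgebra of an ambient C*-algebra, so that its
  C*-completion is \<open>closure Alg\<close>.  The representation is given on the completion; values of \<open>Rep\<close>
  outside \<open>closure Alg\<close> are irrelevant.\<close>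

record (overloaded) ('a, 'h) spectral_data =
  Alg :: "'a set"
  Rep :: "'a \<Rightarrow> 'h::real_normed_vector \<Rightarrow>\<^sub>L 'h"
  Dom :: "'h set"
  Dirac :: "'h \<Rightarrow> 'h"

definition faithful_rep :: "'a::cstar_algebra set \<Rightarrow> ('a \<Rightarrow> 'h::chilbert_space \<Rightarrow>\<^sub>L 'h) \<Rightarrow> bool" where
  "faithful_rep A \<pi> \<longleftrightarrow> \<pi> 1 = id_blinfun \<and>
     (\<forall>a\<in>A. \<forall>b\<in>A. \<pi> (a + b) = \<pi> a + \<pi> b \<and> \<pi> (a * b) = \<pi> a o\<^sub>L \<pi> b) \<and>
     (\<forall>a\<in>A. \<forall>c x. \<pi> (c *\<^sub>C a) x = c *\<^sub>C \<pi> a x \<and> \<pi> a (c *\<^sub>C x) = c *\<^sub>C \<pi> a x) \<and>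
     (\<forall>a\<in>A. \<forall>x y. cinner (\<pi> a x) y = cinner x (\<pi> (star a) y)) \<and>
     (\<forall>a\<in>A. norm (\<pi> a) = norm a)"

definition spectral_triple :: "('a::cstar_algebra, 'h::chilbert_space) spectral_data \<Rightarrow> bool" where
  "spectral_triple T \<longleftrightarrow>
     star_subalgebra (Alg T) \<and>
     faithful_rep (closure (Alg T)) (Rep T) \<and>
     selfadjoint_op (Dom T) (Dirac T) \<and>
     compact_resolvent (Dom T) (Dirac T) \<and>
     (\<forall>a\<in>Alg T. \<forall>x\<in>Dom T. Rep T a x \<in> Dom T) \<and>
     (\<forall>a\<in>Alg T. \<exists>S :: 'h \<Rightarrow>\<^sub>L 'h. \<forall>x\<in>Dom T.
        S x = Dirac T (Rep T a x) - Rep T a (Dirac T x))"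

text \<open>\<open>dcomm T a\<close> is the bounded extension of \<open>[D, a]\<close>, i.e. \<open>d a\<close>.\<close>

definition dcomm :: "('a, 'h::real_normed_vector) spectral_data \<Rightarrow> 'a \<Rightarrow> 'h \<Rightarrow>\<^sub>L 'h" where
  "dcomm T a = (THE S. \<forall>x\<in>Dom T. blinfun_apply S x = Dirac T (Rep T a x) - Rep T a (Dirac T x))"

text \<open>In the next two definitions the real span is also the complex span, since the algebra
  contains the complex multiples of its elements.\<close>

definition one_forms :: "('a, 'h::real_normed_vector) spectral_data \<Rightarrow> ('h \<Rightarrow>\<^sub>L 'h) set" where
  "one_forms T = span {Rep T a o\<^sub>L dcomm T b | a b. a \<in> Alg T \<and> b \<in> Alg T}"

definition two_form_ops :: "('a, 'h::real_normed_vector) spectral_data \<Rightarrow> ('h \<Rightarrow>\<^sub>L 'h) set" where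
  "two_form_ops T = span {Rep T a o\<^sub>L dcomm T b o\<^sub>L dcomm T c | a b c.
     a \<in> Alg T \<and> b \<in> Alg T \<and> c \<in> Alg T}"

text \<open>\<open>d (\<Sum>\<^sub>i a\<^sub>i [D, b\<^sub>i]) = \<Sum>\<^sub>i [D, a\<^sub>i] [D, b\<^sub>i]\<close>, where the right-hand side depends on the chosen
  \<open>a\<^sub>i, b\<^sub>i\<close>.  The set of all its values is a coset of the junk forms
  \<open>{\<Sum>\<^sub>i [D, a\<^sub>i] [D, b\<^sub>i]. \<Sum>\<^sub>i a\<^sub>i [D, b\<^sub>i] = 0}\<close>, hence an element of Connes' \<open>\<Omega>\<^sup>2(D)\<close>.\<close>

definition d_one ::
  "('a, 'h::real_normed_vector) spectral_data \<Rightarrow> ('h \<Rightarrow>\<^sub>L 'h) \<Rightarrow> ('h \<Rightarrow>\<^sub>L 'h) set" where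
  "d_one T \<omega> = {(\<Sum>i<k. dcomm T (a i) o\<^sub>L dcomm T (b i)) | k a b.
     (\<forall>i<k::nat. a i \<in> Alg T \<and> b i \<in> Alg T) \<and> (\<Sum>i<k. Rep T (a i) o\<^sub>L dcomm T (b i)) = \<omega>}"

definition junk_two :: "('a, 'h::real_normed_vector) spectral_data \<Rightarrow> ('h \<Rightarrow>\<^sub>L 'h) set" where
  "junk_two T = d_one T 0"

definition two_forms :: "('a, 'h::real_normed_vector) spectral_data \<Rightarrow> ('h \<Rightarrow>\<^sub>L 'h) set set" where
  "two_forms T = {S +o junk_two T | S. S \<in> two_form_ops T}"

definition wedge ::
  "('a, 'h::real_normed_vector) spectral_data \<Rightarrow> ('h \<Rightarrow>\<^sub>L 'h) \<Rightarrow> ('h \<Rightarrow>\<^sub>L 'h) \<Rightarrow> ('h \<Rightarrow>\<^sub>L 'h) set" where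
  "wedge T \<omega> \<eta> = (\<omega> o\<^sub>L \<eta>) +o junk_two T"

definition one_forms_mod ::
  "('a, 'h::real_normed_vector) spectral_data \<Rightarrow> ('a, 'h \<Rightarrow>\<^sub>L 'h) lmod" where
  "one_forms_mod T = (one_forms T, \<lambda>a \<omega>. Rep T a o\<^sub>L \<omega>)"

definition two_forms_mod ::
  "('a, 'h::real_normed_vector) spectral_data \<Rightarrow> ('a, ('h \<Rightarrow>\<^sub>L 'h) set) lmod" where
  "two_forms_mod T = (two_forms T, \<lambda>a X. (\<lambda>S. Rep T a o\<^sub>L S) ` X + junk_two T)"

section \<open>Connections and curvature\<close>

context
  fixes T :: "('a::cstar_algebra, 'h::chilbert_space) spectral_data"
    and E :: "('a, 'm::{ab_group_add}) rmod"
begin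

abbreviation tensor_one where
  "tensor_one \<equiv> tensor (Alg T) E (one_forms_mod T)"

abbreviation tensor_two where
  "tensor_two \<equiv> tensor (Alg T) E (two_forms_mod T)"

definition right_mult where
  "right_mult X x = tensor_lift (Alg T) E (one_forms_mod T) tensor_one
     (\<lambda>\<xi> \<omega>. tens (Alg T) E (one_forms_mod T) \<xi> (\<omega> o\<^sub>L Rep T x)) X"

definition right_wedge where
  "right_wedge X \<eta> = tensor_lift (Alg T) E (one_forms_mod T) tensor_two
     (\<lambda>\<xi> \<omega>. tens (Alg T) E (two_forms_mod T) \<xi> (wedge T \<omega> \<eta>)) X"

text \<open>The third condition is complex homogeneity: complex scalars act on \<open>E\<close> and on
  \<open>E \<otimes> \<Omega>\<^sup>1\<close> through the multiples of \<open>1\<close> in the algebra.\<close>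

definition is_connection where
  "is_connection nabla \<longleftrightarrow>
     nabla \<in> fst E \<rightarrow> tensor_one \<and>
     additive_on (fst E) nabla \<and>
     (\<forall>\<xi>\<in>fst E. \<forall>c::complex. nabla (snd E \<xi> (c *\<^sub>C 1)) = right_mult (nabla \<xi>) (c *\<^sub>C 1)) \<and>
     (\<forall>\<xi>\<in>fst E. \<forall>x\<in>Alg T. nabla (snd E \<xi> x) =
        right_mult (nabla \<xi>) x + tens (Alg T) E (one_forms_mod T) \<xi> (dcomm T x))"

text \<open>The extension \<open>E \<otimes> \<Omega>\<^sup>1 \<rightarrow> E \<otimes> \<Omega>\<^sup>2\<close>, \<open>\<xi> \<otimes> \<omega> \<mapsto> \<nabla>(\<xi>) \<omega> + \<xi> \<otimes> d \<omega>\<close>.\<close>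

definition extend_connection where
  "extend_connection nabla = tensor_lift (Alg T) E (one_forms_mod T) tensor_two
     (\<lambda>\<xi> \<omega>. right_wedge (nabla \<xi>) \<omega> + tens (Alg T) E (two_forms_mod T) \<xi> (d_one T \<omega>))"

definition curvature where
  "curvature nabla \<xi> = extend_connection nabla (nabla \<xi>)"

text \<open>The zero of a tensor product is the coset \<open>tensor_rel\<close>.\<close>

definition is_flat where
  "is_flat nabla \<longleftrightarrow> (\<forall>\<xi>\<in>fst E. curvature nabla \<xi> = tensor_rel (Alg T) E (two_forms_mod T))"

end

section \<open>Coverings and lifts\<close>

definition nc_covering :: "'b::cstar_algebra set \<Rightarrow> 'g monoid \<Rightarrow> ('g \<Rightarrow> 'b \<Rightarrow> 'b) \<Rightarrow> bool" where
  "nc_covering A G act \<longleftrightarrow>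
     group G \<and> finite (carrier G) \<and>
     (\<forall>a. act (one G) a = a) \<and>
     (\<forall>g\<in>carrier G. \<forall>h\<in>carrier G. \<forall>a. act (mult G g h) a = act g (act h a)) \<and>
     (\<forall>g\<in>carrier G. \<forall>a b. act g (a + b) = act g a + act g b \<and> act g (a * b) = act g a * act g b) \<and>
     (\<forall>g\<in>carrier G. \<forall>c a. act g (c *\<^sub>C a) = c *\<^sub>C act g a) \<and>
     (\<forall>g\<in>carrier G. \<forall>a. act g (star a) = star (act g a)) \<and>
     (\<forall>g\<in>carrier G. g \<noteq> one G \<longrightarrow> (\<exists>a. act g a \<noteq> a)) \<and>
     A = {a. \<forall>g\<in>carrier G. act g a = a} \<and>
     fg_projective A (UNIV, (*))"

definition hilbert_product :: "'g monoid \<Rightarrow> ('g \<Rightarrow> 'b::cstar_algebra \<Rightarrow> 'b) \<Rightarrow> 'b \<Rightarrow> 'b \<Rightarrow> 'b" where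
  "hilbert_product G act a b = (\<Sum>g\<in>carrier G. act g (star a * b))"

text \<open>The Hilbert space \<open>'k\<close>, with \<open>t\<close> as \<open>\<otimes>\<close>, is \<open>A' \<otimes>\<^sub>A H\<close>: the map from the algebraic tensor
  product is bijective, and the inner product is the prescribed one.  No completion is needed since
  \<open>A'\<close> is a finitely generated projective \<open>A\<close>-module.  \<open>U\<close> is the action \<open>g (a \<otimes> x) = g a \<otimes> x\<close> of \<open>G\<close>.\<close>

definition lifted_space ::
  "'g monoid \<Rightarrow> ('g \<Rightarrow> 'b::cstar_algebra \<Rightarrow> 'b) \<Rightarrow> ('b, 'h::chilbert_space) spectral_data
    \<Rightarrow> ('b \<Rightarrow> 'h \<Rightarrow> 'k::chilbert_space) \<Rightarrow> ('g \<Rightarrow> 'k \<Rightarrow> 'k) \<Rightarrow> bool" where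
  "lifted_space G act T t U \<longleftrightarrow>
     (let A = closure (Alg T); M = (UNIV, (*)); N = (UNIV, \<lambda>a. blinfun_apply (Rep T a)) in
       \<exists>h. bij_betw h (tensor A M N) UNIV \<and> additive_on (tensor A M N) h \<and>
         (\<forall>a x. h (tens A M N a x) = t a x)) \<and>
     (\<forall>c a x. t (c *\<^sub>C a) x = c *\<^sub>C t a x) \<and>
     (\<forall>a b x y. cinner (t a x) (t b y) =
        1 / of_nat (card (carrier G)) * cinner x (Rep T (hilbert_product G act a b) y)) \<and>
     (\<forall>g\<in>carrier G. additive_on UNIV (U g) \<and> (\<forall>a x. U g (t a x) = t (act g a) x))"

definition is_lift ::
  "'g monoid \<Rightarrow> ('g \<Rightarrow> 'b::cstar_algebra \<Rightarrow> 'b) \<Rightarrow> ('b, 'h::chilbert_space) spectral_data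
    \<Rightarrow> ('b \<Rightarrow> 'h \<Rightarrow> 'k::chilbert_space) \<Rightarrow> ('g \<Rightarrow> 'k \<Rightarrow> 'k) \<Rightarrow> ('b, 'k) spectral_data \<Rightarrow> bool" where
  "is_lift G act T t U T' \<longleftrightarrow>
     spectral_triple T' \<and>
     (\<forall>a b x. Rep T' a (t b x) = t (a * b) x) \<and>
     closure (Alg T') = UNIV \<and>
     (\<forall>x\<in>Dom T. t 1 x \<in> Dom T' \<and> Dirac T' (t 1 x) = t 1 (Dirac T x)) \<and>
     (\<forall>g\<in>carrier G. \<forall>x\<in>Dom T'. U g x \<in> Dom T' \<and> Dirac T' (U g x) = U g (Dirac T' x))"

text \<open>The identifications \<open>\<Omega>\<^sup>j(D') = \<A>' \<otimes> \<Omega>\<^sup>j(D)\<close> in degrees 1 and 2, with \<open>a \<otimes> b [D, c]\<close> corresponding to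
  \<open>a b [D', c]\<close> and \<open>a \<otimes> b [D, c] [D, c']\<close> to \<open>a b [D', c] [D', c']\<close>.  The second does not follow
  from the first, because the junk of \<open>D'\<close> can be larger than the one coming from \<open>D\<close>.  Without it
  flatness can fail: take \<open>\<A> = M\<^sub>2(\<complex>)\<close> on \<open>\<complex>\<^sup>2 \<otimes> \<complex>\<^sup>2\<close> with \<open>D = (\<sigma>\<^sub>3 + \<mu>) \<otimes> \<sigma>\<^sub>1\<close>, \<open>\<mu> \<noteq> 0\<close> real,
  \<open>\<A>' = \<A> \<oplus> \<A>\<close> with the flip, \<open>D' (x, y) = (D y, D x)\<close>, and the sign representation.\<close>

definition one_forms_iso ::
  "('b::cstar_algebra, 'h::chilbert_space) spectral_data \<Rightarrow> ('b, 'k::chilbert_space) spectral_data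
    \<Rightarrow> (('b \<times> ('h \<Rightarrow>\<^sub>L 'h) \<Rightarrow>\<^sub>0 int) set \<Rightarrow> ('k \<Rightarrow>\<^sub>L 'k)) \<Rightarrow> bool" where
  "one_forms_iso T T' \<Theta> \<longleftrightarrow>
     (let M = (Alg T', (*)); N = one_forms_mod T in
       bij_betw \<Theta> (tensor (Alg T) M N) (one_forms T') \<and> additive_on (tensor (Alg T) M N) \<Theta> \<and>
       (\<forall>a\<in>Alg T'. \<forall>b\<in>Alg T. \<forall>c\<in>Alg T.
          \<Theta> (tens (Alg T) M N a (Rep T b o\<^sub>L dcomm T c)) = Rep T' (a * b) o\<^sub>L dcomm T' c))"

definition two_forms_iso ::
  "('b::cstar_algebra, 'h::chilbert_space) spectral_data \<Rightarrow> ('b, 'k::chilbert_space) spectral_data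
    \<Rightarrow> (('b \<times> ('h \<Rightarrow>\<^sub>L 'h) set \<Rightarrow>\<^sub>0 int) set \<Rightarrow> ('k \<Rightarrow>\<^sub>L 'k) set) \<Rightarrow> bool" where
  "two_forms_iso T T' \<Theta> \<longleftrightarrow>
     (let M = (Alg T', (*)); N = two_forms_mod T in
       bij_betw \<Theta> (tensor (Alg T) M N) (two_forms T') \<and> additive_on (tensor (Alg T) M N) \<Theta> \<and>
       (\<forall>a\<in>Alg T'. \<forall>b\<in>Alg T. \<forall>c\<in>Alg T. \<forall>c'\<in>Alg T.
          \<Theta> (tens (Alg T) M N a ((Rep T b o\<^sub>L dcomm T c o\<^sub>L dcomm T c') +o junk_two T)) =
            (Rep T' (a * b) o\<^sub>L dcomm T' c o\<^sub>L dcomm T' c') +o junk_two T'))"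

section \<open>The connection of a linear representation\<close>

definition linear_representation :: "'g monoid \<Rightarrow> ('g \<Rightarrow> complex ^ 'n ^ 'n) \<Rightarrow> bool" where
  "linear_representation G \<rho> \<longleftrightarrow>
     (\<forall>g\<in>carrier G. invertible (\<rho> g)) \<and>
     (\<forall>g\<in>carrier G. \<forall>h\<in>carrier G. \<rho> (mult G g h) = \<rho> g ** \<rho> h)"

text \<open>\<open>\<Sum>\<^sub>i a\<^sub>i \<otimes> x\<^sub>i \<in> \<A>' \<otimes> \<complex>\<^sup>n\<close> is the vector with components \<open>a\<^sub>i\<close>, so that
  \<open>g (a\<^sub>j \<otimes> x\<^sub>j) = g a\<^sub>j \<otimes> \<rho>(g) x\<^sub>j\<close> gives the action \<open>twisted_action\<close> below.\<close>

definition vec_rmult :: "'b::times ^ 'n \<Rightarrow> 'b \<Rightarrow> 'b ^ 'n" where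
  "vec_rmult \<xi> x = (\<chi> i. \<xi> $ i * x)"

definition free_mod :: "('b::times, 'k::real_normed_vector) spectral_data \<Rightarrow> ('b, 'b ^ 'n) rmod" where
  "free_mod T' = ({\<xi>. \<forall>i. \<xi> $ i \<in> Alg T'}, vec_rmult)"

definition twisted_action ::
  "('g \<Rightarrow> 'b::cstar_algebra \<Rightarrow> 'b) \<Rightarrow> ('g \<Rightarrow> complex ^ 'n ^ 'n) \<Rightarrow> 'g \<Rightarrow> 'b ^ 'n \<Rightarrow> 'b ^ 'n" where
  "twisted_action act \<rho> g \<xi> = (\<chi> i. \<Sum>j\<in>UNIV. (\<rho> g $ i $ j) *\<^sub>C act g (\<xi> $ j))"

definition invariant_mod ::
  "'g monoid \<Rightarrow> ('g \<Rightarrow> 'b::cstar_algebra \<Rightarrow> 'b) \<Rightarrow> ('b, 'k::real_normed_vector) spectral_data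
    \<Rightarrow> ('g \<Rightarrow> complex ^ 'n ^ 'n) \<Rightarrow> ('b, 'b ^ 'n) rmod" where
  "invariant_mod G act T' \<rho> =
     ({\<xi> \<in> fst (free_mod T'). \<forall>g\<in>carrier G. twisted_action act \<rho> g \<xi> = \<xi>}, vec_rmult)"

definition averaging ::
  "'g monoid \<Rightarrow> ('g \<Rightarrow> 'b::cstar_algebra \<Rightarrow> 'b) \<Rightarrow> ('g \<Rightarrow> complex ^ 'n ^ 'n) \<Rightarrow> 'b ^ 'n \<Rightarrow> 'b ^ 'n" where
  "averaging G act \<rho> \<xi> = (1 / real (card (carrier G))) *\<^sub>R (\<Sum>g\<in>carrier G. twisted_action act \<rho> g \<xi>)"

definition trivial_connection ::
  "('b::cstar_algebra, 'k::chilbert_space) spectral_data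
    \<Rightarrow> 'b ^ 'n \<Rightarrow> (('b ^ 'n) \<times> ('k \<Rightarrow>\<^sub>L 'k) \<Rightarrow>\<^sub>0 int) set" where
  "trivial_connection T' \<xi> =
     (\<Sum>i\<in>UNIV. tens (Alg T') (free_mod T') (one_forms_mod T') (axis i 1) (dcomm T' (\<xi> $ i)))"

text \<open>\<open>E' \<otimes>\<^bsub>\<A>'\<^esub> \<Omega>\<^sup>1(D') = E' \<otimes>\<^bsub>\<A>'\<^esub> (\<A>' \<otimes>\<^bsub>\<A>\<^esub> \<Omega>\<^sup>1(D)) = E' \<otimes>\<^bsub>\<A>\<^esub> \<Omega>\<^sup>1(D)\<close>: the first
  identification is \<open>id \<otimes> \<Theta>\<^sup>-\<^sup>1\<close>, the second is \<open>\<xi> \<otimes> (a \<otimes> \<omega>) \<mapsto> \<xi> a \<otimes> \<omega>\<close>.\<close>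

definition change_base ::
  "('b::cstar_algebra, 'h::chilbert_space) spectral_data \<Rightarrow> ('b, 'k::chilbert_space) spectral_data
    \<Rightarrow> (('b \<times> ('h \<Rightarrow>\<^sub>L 'h) \<Rightarrow>\<^sub>0 int) set \<Rightarrow> ('k \<Rightarrow>\<^sub>L 'k))
    \<Rightarrow> (('b ^ 'n) \<times> ('k \<Rightarrow>\<^sub>L 'k) \<Rightarrow>\<^sub>0 int) set \<Rightarrow> (('b ^ 'n) \<times> ('h \<Rightarrow>\<^sub>L 'h) \<Rightarrow>\<^sub>0 int) set" where
  "change_base T T' \<Theta> =
     (let M = (Alg T', (*)); N = one_forms_mod T; K = tensor (Alg T) (free_mod T') N in
       tensor_lift (Alg T') (free_mod T') (one_forms_mod T') K
         (\<lambda>\<xi> \<omega>'. tensor_lift (Alg T) M N K (\<lambda>a \<omega>. tens (Alg T) (free_mod T') N (vec_rmult \<xi> a) \<omega>)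
            (inv_into (tensor (Alg T) M N) \<Theta> \<omega>')))"

definition rep_connection ::
  "'g monoid \<Rightarrow> ('g \<Rightarrow> 'b::cstar_algebra \<Rightarrow> 'b) \<Rightarrow> ('b, 'h::chilbert_space) spectral_data
    \<Rightarrow> ('b, 'k::chilbert_space) spectral_data
    \<Rightarrow> (('b \<times> ('h \<Rightarrow>\<^sub>L 'h) \<Rightarrow>\<^sub>0 int) set \<Rightarrow> ('k \<Rightarrow>\<^sub>L 'k)) \<Rightarrow> ('g \<Rightarrow> complex ^ 'n ^ 'n)
    \<Rightarrow> 'b ^ 'n \<Rightarrow> (('b ^ 'n) \<times> ('h \<Rightarrow>\<^sub>L 'h) \<Rightarrow>\<^sub>0 int) set" where
  "rep_connection G act T T' \<Theta> \<rho> \<xi> =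
     (let N = one_forms_mod T; E = invariant_mod G act T' \<rho>;
          e_tensor_1 = tensor_lift (Alg T) (free_mod T') N (tensor (Alg T) E N)
            (\<lambda>\<xi> \<omega>. tens (Alg T) E N (averaging G act \<rho> \<xi>) \<omega>)
      in e_tensor_1 (change_base T T' \<Theta> (trivial_connection T' \<xi>)))"

end

theory Submission
  imports Defs
begin

text \<open>Write \<open>\<pi>\<^sub>i\<close> for the \<open>i\<close>-th coordinate map of \<open>\<A>'\<^sup>n\<close>.  Since \<open>\<Theta>\<close> intertwines \<open>g \<otimes> 1\<close> with conjugation by
  \<open>U g\<close>, which sends \<open>[D', a]\<close> to \<open>[D', g a]\<close>, the form \<open>\<nabla>' \<xi>\<close> is already invariant for \<open>\<xi> \<in> E\<close>, so that
  \<open>\<Theta> (\<pi>\<^sub>i \<otimes> 1) (\<nabla> \<xi>) = [D', \<xi>\<^sub>i]\<close>.  Writing \<open>\<nabla> \<xi> = \<Sum>\<^sub>k \<xi>\<^sub>k \<otimes> [D, c\<^sub>k]\<close>, the curvature of \<open>\<xi>\<close> is sent by the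
  degree-two isomorphism and \<open>\<pi>\<^sub>i\<close> to the class of \<open>\<Sum>\<^sub>k [D', (\<xi>\<^sub>k)\<^sub>i] [D', c\<^sub>k]\<close>, which is \<open>d [D', \<xi>\<^sub>i] = 0\<close>.
  These maps are jointly injective because \<open>E\<close> is a direct summand of \<open>\<A>'\<^sup>n\<close>.\<close>

section \<open>Tensor products\<close>

text \<open>The obstacle is that a tensor product, and likewise \<open>two_forms\<close>, is a set
  of cosets in a type whose addition is elementwise addition of sets. That addition has no
  negatives, and its neutral element is the singleton of 0, in general not the zero coset
  \<open>tensor_rel\<close>. Hence subtraction takes place in the free abelian group below, zero is
  recognised through \<open>X + Y = X\<close>, and sums of cosets run over nonempty index sets. Maps
  out of a tensor product are compared on elementary tensors. In degree one the generators
  \<open>\<xi> \<otimes> [D, c]\<close> suffice, and on them the extension of a connection reduces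
  to \<open>\<nabla>(\<xi>) [D, c]\<close>. So no representation of \<open>\<nabla> \<xi>\<close>
  has to be chosen: for every element of \<open>E \<otimes> \<Omega>\<^sup>1(D)\<close>, each
  coordinate of the extended connection is the differential of the lifted triple, and flatness is
  the vanishing of its square. The Leibniz rule passes through the idempotent, which is
  \<open>\<A>\<close>-linear and fixes \<open>E\<close>. Invariance of
  \<open>\<nabla>' \<xi>\<close>, and with it the isometric action on the Hilbert space, enters when
  the coordinates of \<open>\<nabla> \<xi>\<close> are evaluated.\<close>

definition add_subgroup :: "'a::ab_group_add set \<Rightarrow> bool" where
  "add_subgroup S \<longleftrightarrow> 0 \<in> S \<and> (\<forall>x\<in>S. \<forall>y\<in>S. x - y \<in> S)"

lemma add_subgroup_zero: "add_subgroup S \<Longrightarrow> 0 \<in> S"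
  by (simp add: add_subgroup_def)

lemma add_subgroup_diff: "add_subgroup S \<Longrightarrow> x \<in> S \<Longrightarrow> y \<in> S \<Longrightarrow> x - y \<in> S"
  by (simp add: add_subgroup_def)

lemma add_subgroup_uminus: "add_subgroup S \<Longrightarrow> x \<in> S \<Longrightarrow> - x \<in> S"
  using add_subgroup_diff[of S 0 x] by (simp add: add_subgroup_zero)

lemma add_subgroup_add: "add_subgroup S \<Longrightarrow> x \<in> S \<Longrightarrow> y \<in> S \<Longrightarrow> x + y \<in> S"
  using add_subgroup_diff[of S x "- y"] by (simp add: add_subgroup_uminus)

lemma add_subgroup_group_closure: "add_subgroup (group_closure S)"
  by (auto simp: add_subgroup_def intro: group_closure.diff)

lemma coset_eq_iff:
  assumes "add_subgroup S" shows "x +o S = y +o S \<longleftrightarrow> x - y \<in> S"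
proof
  assume "x +o S = y +o S"
  moreover have "x \<in> x +o S"
    using set_plus_intro2[OF add_subgroup_zero[OF assms], of x] by simp
  ultimately show "x - y \<in> S" by (simp add: set_plus_imp_minus)
next
  assume xy: "x - y \<in> S"
  have "z - x \<in> S \<longleftrightarrow> z - y \<in> S" for z
    using add_subgroup_add[OF assms _ xy, of "z - x"] add_subgroup_diff[OF assms _ xy, of "z - y"]
    by auto
  then show "x +o S = y +o S"
    by (auto simp: set_eq_iff set_minus_plus[symmetric])
qed

lemma coset_zero_iff: "add_subgroup S \<Longrightarrow> x +o S = S \<longleftrightarrow> x \<in> S"
  using coset_eq_iff[of S x 0] by simp

lemma subgroup_plus_self: "add_subgroup S \<Longrightarrow> S + S = S"
  by (force simp: set_plus_def intro: add_subgroup_add dest: add_subgroup_zero)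

lemma coset_add: "add_subgroup S \<Longrightarrow> (x +o S) + (y +o S) = (x + y) +o S"
  by (simp add: set_plus_rearrange subgroup_plus_self)

text \<open>Nonemptiness matters when the elements are cosets: the empty sum is the singleton of 0,
  in general not the zero coset, and \<open>additive_on\<close> says nothing about a zero.\<close>

lemma additive_on_sum:
  fixes h :: "'a::comm_monoid_add \<Rightarrow> 'b::comm_monoid_add"
  assumes "additive_on S h" "finite I" "I \<noteq> {}" "\<And>i. i \<in> I \<Longrightarrow> X i \<in> S"
    and closed: "\<And>x y. x \<in> S \<Longrightarrow> y \<in> S \<Longrightarrow> x + y \<in> S"
  shows "sum X I \<in> S \<and> h (sum X I) = (\<Sum>i\<in>I. h (X i))"
  using assms(2,3,4)
proof (induction rule: finite_ne_induct)
  case (insert i F)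
  then show ?case using assms(1) closed by (auto simp: additive_on_def)
qed simp

text \<open>The left factor has negatives while the right one has only an addition, so that both the
  operators in \<open>one_forms\<close> and the cosets in \<open>two_forms\<close> fit. The zero of
  the tensor product is therefore produced by \<open>0\<close> on the left and any element on the
  right.\<close>

locale tensor_pair =
  fixes R :: "'r set" and M :: "('r, 'm::ab_group_add) rmod" and N :: "('r, 'n::plus) lmod"
  assumes M_subgroup: "add_subgroup (fst M)"
    and M_action: "m \<in> fst M \<Longrightarrow> r \<in> R \<Longrightarrow> snd M m r \<in> fst M"
    and N_nonempty: "fst N \<noteq> {}"
    and N_add: "n \<in> fst N \<Longrightarrow> n' \<in> fst N \<Longrightarrow> n + n' \<in> fst N"
    and N_action: "n \<in> fst N \<Longrightarrow> r \<in> R \<Longrightarrow> snd N r n \<in> fst N"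
begin

lemma rel_subgroup: "add_subgroup (tensor_rel R M N)"
  by (simp add: tensor_rel_def add_subgroup_group_closure)

lemma tens_in: "m \<in> fst M \<Longrightarrow> n \<in> fst N \<Longrightarrow> tens R M N m n \<in> tensor R M N"
  by (auto simp: tensor_def tens_def)

lemma tens_add_left:
  assumes "m \<in> fst M" "m' \<in> fst M" "n \<in> fst N"
  shows "tens R M N (m + m') n = tens R M N m n + tens R M N m' n"
proof -
  have "frag_of (m + m', n) - frag_of (m, n) - frag_of (m', n) \<in> tensor_rel R M N"
    unfolding tensor_rel_def using assms by (blast intro: group_closure.base)
  then show ?thesis
    by (simp add: tens_def coset_add rel_subgroup coset_eq_iff diff_diff_eq)
qed

lemma tens_add_right:
  assumes "m \<in> fst M" "n \<in> fst N" "n' \<in> fst N"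
  shows "tens R M N m (n + n') = tens R M N m n + tens R M N m n'"
proof -
  have "frag_of (m, n + n') - frag_of (m, n) - frag_of (m, n') \<in> tensor_rel R M N"
    unfolding tensor_rel_def using assms by (blast intro: group_closure.base)
  then show ?thesis
    by (simp add: tens_def coset_add rel_subgroup coset_eq_iff diff_diff_eq)
qed

lemma tens_balanced:
  assumes "m \<in> fst M" "r \<in> R" "n \<in> fst N"
  shows "tens R M N (snd M m r) n = tens R M N m (snd N r n)"
proof -
  have "frag_of (snd M m r, n) - frag_of (m, snd N r n) \<in> tensor_rel R M N"
    unfolding tensor_rel_def using assms by (blast intro: group_closure.base)
  then show ?thesis
    by (simp add: tens_def coset_add rel_subgroup coset_eq_iff)
qed

lemma tensor_add: "X \<in> tensor R M N \<Longrightarrow> Y \<in> tensor R M N \<Longrightarrow> X + Y \<in> tensor R M N"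
proof -
  assume "X \<in> tensor R M N" "Y \<in> tensor R M N"
  then obtain c d where "X = c +o tensor_rel R M N" "Poly_Mapping.keys c \<subseteq> fst M \<times> fst N"
    "Y = d +o tensor_rel R M N" "Poly_Mapping.keys d \<subseteq> fst M \<times> fst N"
    unfolding tensor_def by blast
  then show ?thesis
    unfolding tensor_def using Poly_Mapping.keys_add[of c d]
    by (auto simp: coset_add rel_subgroup intro!: exI[of _ "c + d"])
qed

lemma tensor_add_rel: "X \<in> tensor R M N \<Longrightarrow> X + tensor_rel R M N = X"
  unfolding tensor_def using coset_add[OF rel_subgroup, of _ 0] by auto

text \<open>Addition of sets has no cancellation in general; here both summands are cosets of the
  same subgroup. This is the way in which an element is identified as zero later on.\<close>

lemma tensor_cancel:
  assumes "X \<in> tensor R M N" "Y \<in> tensor R M N" "X + Y = X"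
  shows "Y = tensor_rel R M N"
proof -
  obtain c d where "X = c +o tensor_rel R M N" "Y = d +o tensor_rel R M N"
    using assms unfolding tensor_def by blast
  then show ?thesis
    using assms(3) by (simp add: coset_add rel_subgroup coset_eq_iff coset_zero_iff)
qed

lemma tens_zero_left: "n \<in> fst N \<Longrightarrow> tens R M N 0 n = tensor_rel R M N"
  using tens_add_left[of 0 0 n] add_subgroup_zero[OF M_subgroup]
  by (intro tensor_cancel[of "tens R M N 0 n"]) (auto simp: tens_in)

text \<open>Signs go into the left factor, so that the negative of a generator is again an
  elementary tensor.\<close>

lemma tens_uminus_left:
  assumes "m \<in> fst M" "n \<in> fst N"
  shows "tens R M N (- m) n = (- frag_of (m, n)) +o tensor_rel R M N"
proof -
  have "tens R M N (m + - m) n = tens R M N m n + tens R M N (- m) n"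
    using assms by (intro tens_add_left) (auto simp: add_subgroup_uminus M_subgroup)
  then have "(frag_of (m, n) + frag_of (- m, n)) +o tensor_rel R M N = tensor_rel R M N"
    using assms by (simp add: tens_zero_left) (simp add: tens_def coset_add rel_subgroup)
  then show ?thesis
    by (simp add: tens_def rel_subgroup coset_eq_iff coset_zero_iff add.commute)
qed

lemma rel_in: "tensor_rel R M N \<in> tensor R M N"
proof -
  obtain n where "n \<in> fst N" using N_nonempty by blast
  then show ?thesis
    using tens_zero_left[of n] tens_in[of 0 n] add_subgroup_zero[OF M_subgroup] by simp
qed

text \<open>Integer coefficients are absorbed into the left factor, which leaves no case for zero or
  for negatives.\<close>

lemma tensor_induct [consumes 1, case_names tens add]:
  assumes X: "X \<in> tensor R M N"
    and tens: "\<And>m n. m \<in> fst M \<Longrightarrow> n \<in> fst N \<Longrightarrow> P (tens R M N m n)"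
    and add: "\<And>Y Z. Y \<in> tensor R M N \<Longrightarrow> Z \<in> tensor R M N \<Longrightarrow> P Y \<Longrightarrow> P Z \<Longrightarrow> P (Y + Z)"
  shows "P X"
proof -
  let ?R = "tensor_rel R M N"
  let ?Q = "\<lambda>Y. Y \<in> tensor R M N \<and> P Y"
  obtain c where c: "X = c +o ?R" "Poly_Mapping.keys c \<subseteq> fst M \<times> fst N"
    using X unfolding tensor_def by blast
  \<comment> \<open>\<open>frag_induction\<close> has a difference step, but cosets cannot be
    subtracted, so \<open>c\<close> and \<open>- c\<close> are carried along together.\<close>
  have "?Q (c +o ?R) \<and> ?Q ((- c) +o ?R)"
    using c(2)
  proof (induction rule: frag_induction)
    case zero
    obtain n where n: "n \<in> fst N" using N_nonempty by blast
    have "P ?R"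
      using tens[OF add_subgroup_zero[OF M_subgroup] n] tens_zero_left[OF n] by simp
    then show ?case by (simp add: rel_in)
  next
    case (one x)
    obtain m n where x: "x = (m, n)" "m \<in> fst M" "n \<in> fst N" using one by auto
    have m: "- m \<in> fst M" by (rule add_subgroup_uminus[OF M_subgroup x(2)])
    show ?case
      using tens[OF x(2,3)] tens_in[OF x(2,3)] tens[OF m x(3)] tens_in[OF m x(3)]
        tens_uminus_left[OF x(2,3)]
      by (simp add: tens_def x(1))
  next
    case (diff a b)
    have "(a - b) +o ?R = (a +o ?R) + ((- b) +o ?R)" "(- (a - b)) +o ?R = ((- a) +o ?R) + (b +o ?R)"
      by (simp_all add: coset_add rel_subgroup)
    then show ?case using diff add tensor_add by auto
  qed
  then show ?thesis using c by simp
qed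

lemma additive_on_eqI:
  assumes "additive_on (tensor R M N) h" "additive_on (tensor R M N) h'"
    and "\<And>m n. m \<in> fst M \<Longrightarrow> n \<in> fst N \<Longrightarrow> h (tens R M N m n) = h' (tens R M N m n)"
    and "X \<in> tensor R M N"
  shows "h X = h' X"
  using assms(4)
proof (induction rule: tensor_induct)
  case (add Y Z)
  then show ?case using assms(1,2) by (simp add: additive_on_def)
qed (simp add: assms)

end

definition balanced_map ::
  "'r set \<Rightarrow> ('r, 'm::plus) rmod \<Rightarrow> ('r, 'n::plus) lmod \<Rightarrow> ('m \<Rightarrow> 'n \<Rightarrow> 'k::plus) \<Rightarrow> bool" where
  "balanced_map R M N f \<longleftrightarrow>
     (\<forall>n\<in>fst N. additive_on (fst M) (\<lambda>m. f m n)) \<and>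
     (\<forall>m\<in>fst M. additive_on (fst N) (f m)) \<and>
     (\<forall>m\<in>fst M. \<forall>r\<in>R. \<forall>n\<in>fst N. f (snd M m r) n = f m (snd N r n))"

text \<open>Choose a representative of each value \<open>f m n\<close>, extend linearly to the free
  group, and pass to the quotients: balancedness of \<open>f\<close> sends the generating relations
  into the relations of the target.\<close>

lemma additive_on_from_tensor_exists:
  assumes "tensor_pair R M N" "tensor_pair R' M' N'"
    and f_in: "\<And>m n. m \<in> fst M \<Longrightarrow> n \<in> fst N \<Longrightarrow> f m n \<in> tensor R' M' N'"
    and bal: "balanced_map R M N f"
  shows "\<exists>h. h \<in> tensor R M N \<rightarrow>\<^sub>E tensor R' M' N' \<and> additive_on (tensor R M N) h \<and>
     (\<forall>m\<in>fst M. \<forall>n\<in>fst N. h (tens R M N m n) = f m n)"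
proof -
  interpret P: tensor_pair R M N by fact
  interpret Q: tensor_pair R' M' N' by fact
  let ?S = "tensor_rel R M N" and ?S' = "tensor_rel R' M' N'"
  have "\<forall>x\<in>fst M \<times> fst N. \<exists>c. f (fst x) (snd x) = c +o ?S' \<and> Poly_Mapping.keys c \<subseteq> fst M' \<times> fst N'"
    using f_in unfolding tensor_def by fastforce
  then obtain \<phi> where \<phi>: "\<And>m n. m \<in> fst M \<Longrightarrow> n \<in> fst N \<Longrightarrow> f m n = \<phi> (m, n) +o ?S'"
    "\<And>m n. m \<in> fst M \<Longrightarrow> n \<in> fst N \<Longrightarrow> Poly_Mapping.keys (\<phi> (m, n)) \<subseteq> fst M' \<times> fst N'"
    unfolding bchoice_iff by fastforce
  have rel: "frag_extend \<phi> s \<in> ?S'" if "s \<in> ?S" for s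
    using that unfolding tensor_rel_def[of R M N]
  proof (induction rule: group_closure.induct)
    case (base s)
    have *: "\<phi> (m + m', n) - \<phi> (m, n) - \<phi> (m', n) \<in> ?S'"
      if "m \<in> fst M" "m' \<in> fst M" "n \<in> fst N" for m m' n
    proof -
      have "f (m + m') n = f m n + f m' n"
        using bal that by (simp add: balanced_map_def additive_on_def)
      then show ?thesis
        using that by (simp add: \<phi> coset_add Q.rel_subgroup coset_eq_iff diff_diff_eq
            add_subgroup_add P.M_subgroup)
    qed
    moreover have "\<phi> (m, n + n') - \<phi> (m, n) - \<phi> (m, n') \<in> ?S'"
      if "m \<in> fst M" "n \<in> fst N" "n' \<in> fst N" for m n n'
    proof -
      have "f m (n + n') = f m n + f m n'"
        using bal that by (simp add: balanced_map_def additive_on_def)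
      then show ?thesis
        using that by (simp add: \<phi> coset_add Q.rel_subgroup coset_eq_iff diff_diff_eq P.N_add)
    qed
    moreover have "\<phi> (snd M m r, n) - \<phi> (m, snd N r n) \<in> ?S'"
      if "m \<in> fst M" "r \<in> R" "n \<in> fst N" for m n r
    proof -
      have "f (snd M m r) n = f m (snd N r n)"
        using bal that by (simp add: balanced_map_def)
      then show ?thesis
        using that by (simp add: \<phi> Q.rel_subgroup coset_eq_iff P.M_action P.N_action)
    qed
    ultimately show ?case
      using base add_subgroup_zero[OF Q.rel_subgroup] by (auto simp: frag_extend_diff)
  next
    case (diff s t)
    then show ?case by (simp add: frag_extend_diff add_subgroup_diff Q.rel_subgroup)
  qed
  \<comment> \<open>Two representatives of \<open>X\<close> differ by a relation, so by
    \<open>rel\<close> the coset built from the chosen one does not depend on the choice.\<close>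
  define k where "k X = (SOME c. X = c +o ?S \<and> Poly_Mapping.keys c \<subseteq> fst M \<times> fst N)" for X
  have k: "X = k X +o ?S \<and> Poly_Mapping.keys (k X) \<subseteq> fst M \<times> fst N" if "X \<in> tensor R M N" for X
    unfolding k_def by (rule someI_ex) (use that in \<open>auto simp: tensor_def\<close>)
  \<comment> \<open>\<open>tensor_lift\<close> selects among extensional functions; restricting the
    domain is what makes the map unique there.\<close>
  define h where "h = (\<lambda>X\<in>tensor R M N. frag_extend \<phi> (k X) +o ?S')"
  have h: "h (c +o ?S) = frag_extend \<phi> c +o ?S'" if "Poly_Mapping.keys c \<subseteq> fst M \<times> fst N" for c
  proof -
    have X: "c +o ?S \<in> tensor R M N" using that by (auto simp: tensor_def)
    have "k (c +o ?S) - c \<in> ?S"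
      using k[OF X] by (metis coset_eq_iff[OF P.rel_subgroup])
    from rel[OF this] show ?thesis
      using X by (simp add: h_def coset_eq_iff Q.rel_subgroup frag_extend_diff)
  qed
  have "h (tens R M N m n) = f m n" if "m \<in> fst M" "n \<in> fst N" for m n
    using that unfolding tens_def by (subst h) (auto simp: \<phi>)
  moreover have "additive_on (tensor R M N) h"
    unfolding additive_on_def
  proof (intro ballI)
    fix X Y assume "X \<in> tensor R M N" "Y \<in> tensor R M N"
    then obtain c d where c: "X = c +o ?S" "Poly_Mapping.keys c \<subseteq> fst M \<times> fst N"
      and d: "Y = d +o ?S" "Poly_Mapping.keys d \<subseteq> fst M \<times> fst N"
      unfolding tensor_def by blast
    then have "Poly_Mapping.keys (c + d) \<subseteq> fst M \<times> fst N"
      using Poly_Mapping.keys_add[of c d] by blast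
    then show "h (X + Y) = h X + h Y"
      using c d by (simp add: coset_add P.rel_subgroup Q.rel_subgroup h frag_extend_add)
  qed
  moreover have "h \<in> tensor R M N \<rightarrow>\<^sub>E tensor R' M' N'"
  proof (rule PiE_I)
    fix X assume "X \<in> tensor R M N"
    then obtain c where c: "X = c +o ?S" "Poly_Mapping.keys c \<subseteq> fst M \<times> fst N"
      unfolding tensor_def by blast
    then have "Poly_Mapping.keys (frag_extend \<phi> c) \<subseteq> fst M' \<times> fst N'"
      using keys_frag_extend[of \<phi> c] \<phi>(2) by fastforce
    then show "h X \<in> tensor R' M' N'"
      using c by (auto simp: h tensor_def)
  qed (simp add: h_def)
  ultimately show ?thesis by blast
qed

lemma
  fixes f :: "'m::ab_group_add \<Rightarrow> 'n::plus \<Rightarrow> ('m'::ab_group_add \<times> 'n'::plus \<Rightarrow>\<^sub>0 int) set"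
  assumes "tensor_pair R M N" "tensor_pair R' M' N'"
    and "\<And>m n. m \<in> fst M \<Longrightarrow> n \<in> fst N \<Longrightarrow> f m n \<in> tensor R' M' N'"
    and "balanced_map R M N f"
  shows tensor_lift_in:
      "X \<in> tensor R M N \<Longrightarrow> tensor_lift R M N (tensor R' M' N') f X \<in> tensor R' M' N'"
    and tensor_lift_additive:
      "additive_on (tensor R M N) (tensor_lift R M N (tensor R' M' N') f)"
    and tensor_lift_tens: "m \<in> fst M \<Longrightarrow> n \<in> fst N \<Longrightarrow>
      tensor_lift R M N (tensor R' M' N') f (tens R M N m n) = f m n"
proof -
  interpret P: tensor_pair R M N by fact
  let ?H = "\<lambda>h. h \<in> tensor R M N \<rightarrow>\<^sub>E tensor R' M' N' \<and> additive_on (tensor R M N) h \<and>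
     (\<forall>m\<in>fst M. \<forall>n\<in>fst N. h (tens R M N m n) = f m n)"
  have "\<exists>!h. ?H h"
  proof (rule ex_ex1I)
    show "\<exists>h. ?H h" by (rule additive_on_from_tensor_exists[OF assms])
    fix h h' assume h: "?H h" "?H h'"
    show "h = h'"
    proof (rule PiE_ext[of h "tensor R M N" "\<lambda>_. tensor R' M' N'"])
      show "h X = h' X" if "X \<in> tensor R M N" for X
        by (rule P.additive_on_eqI[OF _ _ _ that]) (use h in simp_all)
    qed (use h in simp_all)
  qed
  then have "?H (THE h. ?H h)" by (rule theI')
  then have "?H (tensor_lift R M N (tensor R' M' N') f)" by (simp add: tensor_lift_def)
  then show "X \<in> tensor R M N \<Longrightarrow> tensor_lift R M N (tensor R' M' N') f X \<in> tensor R' M' N'"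
    and "additive_on (tensor R M N) (tensor_lift R M N (tensor R' M' N') f)"
    and "m \<in> fst M \<Longrightarrow> n \<in> fst N \<Longrightarrow>
      tensor_lift R M N (tensor R' M' N') f (tens R M N m n) = f m n"
    by auto
qed

definition rmod_hom :: "'r set \<Rightarrow> ('r, 'm::plus) rmod \<Rightarrow> ('r, 'm'::plus) rmod \<Rightarrow> ('m \<Rightarrow> 'm') \<Rightarrow> bool" where
  "rmod_hom R M M' \<phi> \<longleftrightarrow> \<phi> \<in> fst M \<rightarrow> fst M' \<and> additive_on (fst M) \<phi> \<and>
     (\<forall>m\<in>fst M. \<forall>r\<in>R. \<phi> (snd M m r) = snd M' (\<phi> m) r)"

text \<open>The map \<open>\<phi> \<otimes> 1\<close>. It unfolds to the \<open>tensor_lift\<close>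
  of the averaging in \<open>rep_connection\<close> and to the inner one in
  \<open>change_base\<close>.\<close>

definition tensor_map :: "'r set \<Rightarrow> ('r, 'm::plus) rmod \<Rightarrow> ('r, 'm'::plus) rmod \<Rightarrow> ('r, 'n::plus) lmod
    \<Rightarrow> ('m \<Rightarrow> 'm') \<Rightarrow> ('m \<times> 'n \<Rightarrow>\<^sub>0 int) set \<Rightarrow> ('m' \<times> 'n \<Rightarrow>\<^sub>0 int) set" where
  "tensor_map R M M' N \<phi> = tensor_lift R M N (tensor R M' N) (\<lambda>m n. tens R M' N (\<phi> m) n)"

lemma
  assumes M: "tensor_pair R M N" and M': "tensor_pair R M' N" and \<phi>: "rmod_hom R M M' \<phi>"
  shows tensor_map_in: "X \<in> tensor R M N \<Longrightarrow> tensor_map R M M' N \<phi> X \<in> tensor R M' N"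
    and tensor_map_additive: "additive_on (tensor R M N) (tensor_map R M M' N \<phi>)"
    and tensor_map_tens: "m \<in> fst M \<Longrightarrow> n \<in> fst N \<Longrightarrow>
      tensor_map R M M' N \<phi> (tens R M N m n) = tens R M' N (\<phi> m) n"
proof -
  interpret P: tensor_pair R M N by (rule M)
  interpret Q: tensor_pair R M' N by (rule M')
  have \<phi>_in: "\<phi> m \<in> fst M'" if "m \<in> fst M" for m using \<phi> that by (auto simp: rmod_hom_def)
  have in_Q: "tens R M' N (\<phi> m) n \<in> tensor R M' N" if "m \<in> fst M" "n \<in> fst N" for m n
    using that by (simp add: Q.tens_in \<phi>_in)
  have "balanced_map R M N (\<lambda>m n. tens R M' N (\<phi> m) n)"
    using \<phi> unfolding balanced_map_def additive_on_def rmod_hom_def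
    by (auto simp: Q.tens_add_left Q.tens_add_right \<phi>_in Q.tens_balanced)
  note lift = tensor_lift_in[OF M M' in_Q this] tensor_lift_additive[OF M M' in_Q this]
    tensor_lift_tens[OF M M' in_Q this]
  show "X \<in> tensor R M N \<Longrightarrow> tensor_map R M M' N \<phi> X \<in> tensor R M' N"
    "additive_on (tensor R M N) (tensor_map R M M' N \<phi>)"
    "m \<in> fst M \<Longrightarrow> n \<in> fst N \<Longrightarrow> tensor_map R M M' N \<phi> (tens R M N m n) = tens R M' N (\<phi> m) n"
    unfolding tensor_map_def by (use lift in auto)
qed

lemma additive_onD: "additive_on S h \<Longrightarrow> x \<in> S \<Longrightarrow> y \<in> S \<Longrightarrow> h (x + y) = h x + h y"
  by (simp add: additive_on_def)

lemma (in tensor_pair) tensor_sum: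
  "finite I \<Longrightarrow> I \<noteq> {} \<Longrightarrow> (\<And>i. i \<in> I \<Longrightarrow> X i \<in> tensor R M N) \<Longrightarrow> sum X I \<in> tensor R M N"
  by (induction I rule: finite_ne_induct) (auto simp: tensor_add)

lemma (in tensor_pair) tens_sum_left:
  assumes "finite I" "I \<noteq> {}" "\<And>i. i \<in> I \<Longrightarrow> m i \<in> fst M" "n \<in> fst N"
  shows "tens R M N (sum m I) n = (\<Sum>i\<in>I. tens R M N (m i) n)"
  using additive_on_sum[of "fst M" "\<lambda>m. tens R M N m n" I m] assms
  by (auto simp: additive_on_def tens_add_left add_subgroup_add M_subgroup)

text \<open>Additivity gives \<open>Y + Y = Y\<close> for the image \<open>Y\<close> of the zero
  coset, and cancellation holds in the target tensor product.\<close>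

lemma (in tensor_pair) additive_on_rel:
  assumes Q: "tensor_pair R' M' N'" and h: "additive_on (tensor R M N) h"
    and h_in: "\<And>X. X \<in> tensor R M N \<Longrightarrow> h X \<in> tensor R' M' N'"
  shows "h (tensor_rel R M N) = tensor_rel R' M' N'"
proof (rule tensor_pair.tensor_cancel[OF Q])
  show "h (tensor_rel R M N) + h (tensor_rel R M N) = h (tensor_rel R M N)"
    using additive_onD[OF h rel_in rel_in] tensor_add_rel[OF rel_in] by simp
qed (auto intro: h_in rel_in)

section \<open>Differential forms of a spectral triple\<close>

lemmas blinfun_comp_simps =
  bounded_bilinear.add_left[OF bounded_bilinear_blinfun_compose]
  bounded_bilinear.add_right[OF bounded_bilinear_blinfun_compose]
  bounded_bilinear.diff_left[OF bounded_bilinear_blinfun_compose]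
  bounded_bilinear.diff_right[OF bounded_bilinear_blinfun_compose]
  bounded_bilinear.minus_left[OF bounded_bilinear_blinfun_compose]
  bounded_bilinear.minus_right[OF bounded_bilinear_blinfun_compose]
  bounded_bilinear.scaleR_left[OF bounded_bilinear_blinfun_compose]
  bounded_bilinear.scaleR_right[OF bounded_bilinear_blinfun_compose]
  bounded_bilinear.zero_left[OF bounded_bilinear_blinfun_compose]
  bounded_bilinear.zero_right[OF bounded_bilinear_blinfun_compose]

lemma blinfun_comp_assoc: "(f o\<^sub>L g) o\<^sub>L h = f o\<^sub>L (g o\<^sub>L h)"
  by (rule blinfun_eqI) simp

lemma id_blinfun_comp [simp]: "id_blinfun o\<^sub>L S = S"
  by (rule blinfun_eqI) simp

lemma scaleC_zero_left: "0 *\<^sub>C (x :: 'a::complex_vector) = 0"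
  using scaleR_scaleC[of 0 x] by simp

lemma scaleC_one: "1 *\<^sub>C (x :: 'a::complex_vector) = x"
  using scaleR_scaleC[of 1 x] by simp

lemma scaleC_zero_right [simp]: "c *\<^sub>C (0 :: 'a::complex_vector) = 0"
  using scaleC_scaleC[of c 0 "0 :: 'a"] by (simp add: scaleC_zero_left)

lemma scaleC_sum_right: "c *\<^sub>C sum f I = (\<Sum>i\<in>I. c *\<^sub>C (f i :: 'a::complex_vector))"
  by (induction I rule: infinite_finite_induct) (simp_all add: scaleC_add_right)

lemma scaleC_sum_left: "sum f I *\<^sub>C (x :: 'a::complex_vector) = (\<Sum>i\<in>I. f i *\<^sub>C x)"
  by (induction I rule: infinite_finite_induct) (simp_all add: scaleC_add_left scaleC_zero_left)

lemma blinfun_eq_dense: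
  fixes S S' :: "'a::real_normed_vector \<Rightarrow>\<^sub>L 'b::real_normed_vector"
  assumes "closure V = UNIV" "\<And>x. x \<in> V \<Longrightarrow> S x = S' x"
  shows "S = S'"
proof (rule blinfun_eqI)
  fix x
  have "closed {x. S x = S' x}"
    by (intro closed_Collect_eq continuous_intros)
  then have "closure V \<subseteq> {x. S x = S' x}"
    by (intro closure_minimal) (use assms in auto)
  then show "S x = S' x" using assms by auto
qed

text \<open>For \<open>d_one_plus\<close>, where finite families representing two one-forms are
  concatenated.\<close>

lemma sum_lessThan_append:
  fixes f g :: "nat \<Rightarrow> 'a::comm_monoid_add"
  shows "(\<Sum>i<k + l. if i < k then f i else g (i - k)) = (\<Sum>i<k. f i) + (\<Sum>i<l. g i)"
  by (induction l) (auto simp: add.assoc)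

locale spectral =
  fixes T :: "('a::cstar_algebra, 'h::chilbert_space) spectral_data"
  assumes triple: "spectral_triple T"
begin

lemma alg_one: "1 \<in> Alg T"
  and alg_scaleC: "a \<in> Alg T \<Longrightarrow> c *\<^sub>C a \<in> Alg T"
  and alg_add: "a \<in> Alg T \<Longrightarrow> b \<in> Alg T \<Longrightarrow> a + b \<in> Alg T"
  and alg_mult: "a \<in> Alg T \<Longrightarrow> b \<in> Alg T \<Longrightarrow> a * b \<in> Alg T"
  using triple by (auto simp: spectral_triple_def star_subalgebra_def)

lemma alg_scaleR: "a \<in> Alg T \<Longrightarrow> r *\<^sub>R a \<in> Alg T"
  by (simp add: scaleR_scaleC alg_scaleC)

lemma alg_zero: "0 \<in> Alg T"
  using alg_scaleR[OF alg_one, of 0] by simp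

lemma alg_uminus: "a \<in> Alg T \<Longrightarrow> - a \<in> Alg T"
  using alg_scaleR[of a "- 1"] by simp

lemma alg_subgroup: "add_subgroup (Alg T)"
  unfolding add_subgroup_def
  by (metis alg_zero alg_add alg_uminus add_uminus_conv_diff)

lemma alg_sum: "(\<And>i. i \<in> I \<Longrightarrow> f i \<in> Alg T) \<Longrightarrow> sum f I \<in> Alg T"
  by (induction I rule: infinite_finite_induct) (auto simp: alg_zero alg_add)

lemma rep: "faithful_rep (closure (Alg T)) (Rep T)"
  using triple by (simp add: spectral_triple_def)

lemma rep_one: "Rep T 1 = id_blinfun"
  using rep by (simp add: faithful_rep_def)

lemma rep_add: "a \<in> Alg T \<Longrightarrow> b \<in> Alg T \<Longrightarrow> Rep T (a + b) = Rep T a + Rep T b"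
  and rep_mult: "a \<in> Alg T \<Longrightarrow> b \<in> Alg T \<Longrightarrow> Rep T (a * b) = Rep T a o\<^sub>L Rep T b"
  and rep_scaleC: "a \<in> Alg T \<Longrightarrow> Rep T (c *\<^sub>C a) x = c *\<^sub>C Rep T a x"
  using rep by (simp_all add: faithful_rep_def subsetD[OF closure_subset])

lemma rep_scaleR: "a \<in> Alg T \<Longrightarrow> Rep T (r *\<^sub>R a) = r *\<^sub>R Rep T a"
  by (rule blinfun_eqI) (simp add: scaleR_scaleC rep_scaleC blinfun.scaleR_left)

lemma rep_zero: "Rep T 0 = 0"
  using rep_scaleR[OF alg_one, of 0] by simp

lemma rep_uminus: "a \<in> Alg T \<Longrightarrow> Rep T (- a) = - Rep T a"
  using rep_scaleR[of a "- 1"] by simp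

lemma dirac_add: "x \<in> Dom T \<Longrightarrow> y \<in> Dom T \<Longrightarrow> Dirac T (x + y) = Dirac T x + Dirac T y"
  and dirac_scaleC: "x \<in> Dom T \<Longrightarrow> Dirac T (c *\<^sub>C x) = c *\<^sub>C Dirac T x"
  and dom_dense: "closure (Dom T) = UNIV"
  using triple by (simp_all add: spectral_triple_def selfadjoint_op_def)

lemma rep_dom: "a \<in> Alg T \<Longrightarrow> x \<in> Dom T \<Longrightarrow> Rep T a x \<in> Dom T"
  using triple by (simp add: spectral_triple_def)

text \<open>Density of the domain makes a bounded extension of the commutator unique, so the
  description in \<open>dcomm\<close> is legitimate and the sum and product rules can be verified on
  domain vectors.\<close>

lemma dcomm_eqI:
  assumes "\<And>x. x \<in> Dom T \<Longrightarrow> blinfun_apply S x = Dirac T (Rep T a x) - Rep T a (Dirac T x)"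
  shows "dcomm T a = S"
  unfolding dcomm_def by (rule the_equality) (auto simp: assms intro: blinfun_eq_dense[OF dom_dense])

lemma dcomm_apply:
  assumes "a \<in> Alg T" "x \<in> Dom T"
  shows "dcomm T a x = Dirac T (Rep T a x) - Rep T a (Dirac T x)"
proof -
  obtain S :: "'h \<Rightarrow>\<^sub>L 'h" where S: "\<forall>x\<in>Dom T. S x = Dirac T (Rep T a x) - Rep T a (Dirac T x)"
    using triple assms(1) unfolding spectral_triple_def by blast
  then have "dcomm T a = S" by (intro dcomm_eqI) auto
  then show ?thesis using S assms(2) by simp
qed

lemma dcomm_add: "a \<in> Alg T \<Longrightarrow> b \<in> Alg T \<Longrightarrow> dcomm T (a + b) = dcomm T a + dcomm T b"
  by (rule dcomm_eqI) (simp add: rep_add blinfun.add_left dcomm_apply dirac_add rep_dom)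

lemma dcomm_mult:
  "a \<in> Alg T \<Longrightarrow> b \<in> Alg T \<Longrightarrow> dcomm T (a * b) = (dcomm T a o\<^sub>L Rep T b) + (Rep T a o\<^sub>L dcomm T b)"
  by (rule dcomm_eqI) (simp add: rep_mult blinfun.add_left blinfun.diff_right dcomm_apply rep_dom)

lemma dcomm_scaleC_one: "dcomm T (c *\<^sub>C 1) = 0"
  by (rule dcomm_eqI) (simp add: rep_scaleC alg_one rep_one dirac_scaleC)

lemma dcomm_one: "dcomm T 1 = 0"
  using dcomm_scaleC_one[of 1] by (simp add: scaleC_one)

lemma dcomm_scaleC: "a \<in> Alg T \<Longrightarrow> dcomm T (c *\<^sub>C a) x = c *\<^sub>C dcomm T a x"
  using dcomm_mult[OF alg_scaleC[OF alg_one, of c], of a]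
  by (simp add: dcomm_scaleC_one mult_scaleC_left rep_scaleC alg_one rep_one)

lemma dcomm_scaleR: "a \<in> Alg T \<Longrightarrow> dcomm T (r *\<^sub>R a) = r *\<^sub>R dcomm T a"
  by (rule blinfun_eqI) (simp add: scaleR_scaleC dcomm_scaleC blinfun.scaleR_left)

lemma dcomm_uminus: "a \<in> Alg T \<Longrightarrow> dcomm T (- a) = - dcomm T a"
  using dcomm_scaleR[of a "- 1"] by simp

lemma dcomm_sum:
  "(\<And>i. i \<in> I \<Longrightarrow> f i \<in> Alg T) \<Longrightarrow> dcomm T (sum f I) = (\<Sum>i\<in>I. dcomm T (f i))"
proof (induction I rule: infinite_finite_induct)
  case (insert i I)
  then show ?case by (simp add: dcomm_add alg_sum)
qed (use dcomm_scaleC_one[of 0] in \<open>simp_all add: scaleC_zero_left\<close>)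

lemma one_form_gen: "a \<in> Alg T \<Longrightarrow> b \<in> Alg T \<Longrightarrow> Rep T a o\<^sub>L dcomm T b \<in> one_forms T"
  unfolding one_forms_def by (blast intro: span_base)

lemma one_form_dcomm: "b \<in> Alg T \<Longrightarrow> dcomm T b \<in> one_forms T"
  using one_form_gen[OF alg_one, of b] by (simp add: rep_one)

lemma one_form_add: "\<omega> \<in> one_forms T \<Longrightarrow> \<eta> \<in> one_forms T \<Longrightarrow> \<omega> + \<eta> \<in> one_forms T"
  by (simp add: one_forms_def span_add)

lemma one_form_diff: "\<omega> \<in> one_forms T \<Longrightarrow> \<eta> \<in> one_forms T \<Longrightarrow> \<omega> - \<eta> \<in> one_forms T"
  by (simp add: one_forms_def span_diff)

lemma one_form_zero: "0 \<in> one_forms T"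
  by (simp add: one_forms_def span_zero)

text \<open>Real multiples in the span are absorbed into the coefficient \<open>a\<close>, which
  leaves generators and sums.\<close>

lemma one_form_induct [consumes 1, case_names gen add]:
  assumes "\<omega> \<in> one_forms T"
    and gen: "\<And>a b. a \<in> Alg T \<Longrightarrow> b \<in> Alg T \<Longrightarrow> P (Rep T a o\<^sub>L dcomm T b)"
    and add: "\<And>\<omega> \<eta>. \<omega> \<in> one_forms T \<Longrightarrow> \<eta> \<in> one_forms T \<Longrightarrow> P \<omega> \<Longrightarrow> P \<eta> \<Longrightarrow> P (\<omega> + \<eta>)"
  shows "P \<omega>"
proof -
  have "\<omega> \<in> span {Rep T a o\<^sub>L dcomm T b | a b. a \<in> Alg T \<and> b \<in> Alg T}"
    using assms(1) by (simp add: one_forms_def)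
  then have "\<omega> \<in> one_forms T \<and> P \<omega>"
  proof (induction rule: span_induct_alt)
    case base
    show ?case using gen[OF alg_zero alg_zero] by (simp add: one_form_zero rep_zero)
  next
    case (step c x y)
    then obtain a b where ab: "a \<in> Alg T" "b \<in> Alg T" "x = Rep T a o\<^sub>L dcomm T b" by blast
    then have "c *\<^sub>R x = Rep T (c *\<^sub>R a) o\<^sub>L dcomm T b"
      by (simp add: rep_scaleR blinfun_comp_simps)
    then show ?case
      using step ab gen[of "c *\<^sub>R a" b] one_form_gen[of "c *\<^sub>R a" b]
      by (simp add: alg_scaleR add one_form_add)
  qed
  then show ?thesis by simp
qed

lemma one_form_rep_left:
  assumes "\<omega> \<in> one_forms T" "a \<in> Alg T" shows "Rep T a o\<^sub>L \<omega> \<in> one_forms T"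
  using assms(1)
proof (induction rule: one_form_induct)
  case (gen b c)
  then show ?case
    using one_form_gen[of "a * b" c] assms(2) by (simp add: rep_mult alg_mult blinfun_comp_assoc)
qed (simp_all add: blinfun_comp_simps one_form_add)

text \<open>The Leibniz rule moves the right factor inside:
  \<open>b [D, c] a = b [D, c a] - b c [D, a]\<close>.\<close>

lemma one_form_rep_right:
  assumes "\<omega> \<in> one_forms T" "a \<in> Alg T" shows "\<omega> o\<^sub>L Rep T a \<in> one_forms T"
  using assms(1)
proof (induction rule: one_form_induct)
  case (gen b c)
  have "(Rep T b o\<^sub>L dcomm T c) o\<^sub>L Rep T a =
      (Rep T b o\<^sub>L dcomm T (c * a)) - (Rep T (b * c) o\<^sub>L dcomm T a)"
    using gen assms(2) by (simp add: dcomm_mult rep_mult blinfun_comp_assoc blinfun_comp_simps)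
  then show ?case using gen assms(2) by (simp add: one_form_diff one_form_gen alg_mult)
qed (simp add: blinfun_comp_simps one_form_add)

lemma two_form_op_gen:
  "a \<in> Alg T \<Longrightarrow> b \<in> Alg T \<Longrightarrow> c \<in> Alg T \<Longrightarrow> Rep T a o\<^sub>L dcomm T b o\<^sub>L dcomm T c \<in> two_form_ops T"
  unfolding two_form_ops_def by (blast intro: span_base)

lemma two_form_op_add: "S \<in> two_form_ops T \<Longrightarrow> S' \<in> two_form_ops T \<Longrightarrow> S + S' \<in> two_form_ops T"
  by (simp add: two_form_ops_def span_add)

lemma two_form_op_rep_left:
  assumes "a \<in> Alg T" "S \<in> two_form_ops T" shows "Rep T a o\<^sub>L S \<in> two_form_ops T"
proof -
  have "S \<in> span {Rep T a o\<^sub>L dcomm T b o\<^sub>L dcomm T c | a b c.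
     a \<in> Alg T \<and> b \<in> Alg T \<and> c \<in> Alg T}"
    using assms(2) by (simp add: two_form_ops_def)
  then show ?thesis
  proof (induction rule: span_induct_alt)
    case base
    then show ?case by (simp add: two_form_ops_def span_zero)
  next
    case (step r x y)
    then obtain b c d where x: "b \<in> Alg T" "c \<in> Alg T" "d \<in> Alg T"
      "x = Rep T b o\<^sub>L dcomm T c o\<^sub>L dcomm T d" by blast
    then have "Rep T a o\<^sub>L x = Rep T (a * b) o\<^sub>L dcomm T c o\<^sub>L dcomm T d"
      using assms(1) by (simp add: rep_mult blinfun_comp_assoc)
    then have "Rep T a o\<^sub>L x \<in> two_form_ops T"
      using two_form_op_gen[of "a * b" c d] x assms(1) by (simp add: alg_mult)
    then have "r *\<^sub>R (Rep T a o\<^sub>L x) \<in> two_form_ops T" by (simp add: two_form_ops_def span_scale)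
    then show ?case using step by (simp add: blinfun_comp_simps two_form_op_add)
  qed
qed

lemma two_form_op_comp:
  assumes "\<omega> \<in> one_forms T" "\<eta> \<in> one_forms T" shows "\<omega> o\<^sub>L \<eta> \<in> two_form_ops T"
proof -
  have *: "dcomm T b o\<^sub>L \<eta> \<in> two_form_ops T" if b: "b \<in> Alg T" for b
    using assms(2)
  proof (induction rule: one_form_induct)
    case (gen c d)
    \<comment> \<open>\<open>[D, b] c = [D, b c] - b [D, c]\<close> removes the coefficient between
      the two commutators.\<close>
    have "dcomm T b o\<^sub>L (Rep T c o\<^sub>L dcomm T d) =
        (Rep T 1 o\<^sub>L dcomm T (b * c) o\<^sub>L dcomm T d) - (Rep T b o\<^sub>L dcomm T c o\<^sub>L dcomm T d)"
      using gen b by (intro blinfun_eqI) (simp add: dcomm_mult rep_one blinfun.bilinear_simps)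
    then show ?case
      using gen b unfolding two_form_ops_def
      by (auto intro!: span_diff two_form_op_gen[unfolded two_form_ops_def] alg_mult alg_one)
  qed (simp add: blinfun_comp_simps two_form_op_add)
  show ?thesis
    using assms(1)
  proof (induction rule: one_form_induct)
    case (gen a b)
    then show ?case using two_form_op_rep_left[OF _ *] by (simp add: blinfun_comp_assoc)
  qed (simp add: blinfun_comp_simps two_form_op_add)
qed

section \<open>The differential of one-forms modulo junk\<close>

lemma d_one_gen: "a \<in> Alg T \<Longrightarrow> b \<in> Alg T \<Longrightarrow> dcomm T a o\<^sub>L dcomm T b \<in> d_one T (Rep T a o\<^sub>L dcomm T b)"
  unfolding d_one_def by (rule CollectI, rule exI[of _ 1]) auto

lemma d_one_zero: "0 \<in> d_one T 0"
  unfolding d_one_def by (rule CollectI, rule exI[of _ 0]) auto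

lemma d_one_plus:
  assumes "S \<in> d_one T \<omega>" "S' \<in> d_one T \<eta>" shows "S + S' \<in> d_one T (\<omega> + \<eta>)"
proof -
  obtain k a b where 1: "S = (\<Sum>i<k. dcomm T (a i) o\<^sub>L dcomm T (b i))"
    "\<forall>i<k::nat. a i \<in> Alg T \<and> b i \<in> Alg T" "(\<Sum>i<k. Rep T (a i) o\<^sub>L dcomm T (b i)) = \<omega>"
    using assms(1) unfolding d_one_def by blast
  obtain l c d where 2: "S' = (\<Sum>i<l. dcomm T (c i) o\<^sub>L dcomm T (d i))"
    "\<forall>i<l::nat. c i \<in> Alg T \<and> d i \<in> Alg T" "(\<Sum>i<l. Rep T (c i) o\<^sub>L dcomm T (d i)) = \<eta>"
    using assms(2) unfolding d_one_def by blast
  let ?a = "\<lambda>i. if i < k then a i else c (i - k)" and ?b = "\<lambda>i. if i < k then b i else d (i - k)"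
  have "S + S' = (\<Sum>i<k + l. dcomm T (?a i) o\<^sub>L dcomm T (?b i))"
    "\<omega> + \<eta> = (\<Sum>i<k + l. Rep T (?a i) o\<^sub>L dcomm T (?b i))"
    unfolding 1(1) 2(1) 1(3)[symmetric] 2(3)[symmetric] sum_lessThan_append[symmetric]
    by (auto intro!: sum.cong)
  moreover have "\<forall>i<k + l. ?a i \<in> Alg T \<and> ?b i \<in> Alg T" using 1 2 by auto
  ultimately show ?thesis
    unfolding d_one_def by (intro CollectI exI[of _ "k + l"] exI[of _ ?a] exI[of _ ?b]) auto
qed

text \<open>Multiplication by \<open>x\<close> replaces the family \<open>a\<^sub>i\<close> by
  \<open>x a\<^sub>i\<close>, and the Leibniz rule for \<open>[D, x a\<^sub>i]\<close> yields both
  terms. The case \<open>\<omega> = 0\<close> makes junk stable under left multiplication; the case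
  \<open>x = - 1\<close> gives negatives.\<close>

lemma d_one_rep_left:
  assumes "S \<in> d_one T \<omega>" "x \<in> Alg T"
  shows "(dcomm T x o\<^sub>L \<omega>) + (Rep T x o\<^sub>L S) \<in> d_one T (Rep T x o\<^sub>L \<omega>)"
proof -
  obtain k a b where 1: "S = (\<Sum>i<k. dcomm T (a i) o\<^sub>L dcomm T (b i))"
    "\<forall>i<k::nat. a i \<in> Alg T \<and> b i \<in> Alg T" "(\<Sum>i<k. Rep T (a i) o\<^sub>L dcomm T (b i)) = \<omega>"
    using assms(1) unfolding d_one_def by blast
  have "(dcomm T x o\<^sub>L \<omega>) + (Rep T x o\<^sub>L S) = (\<Sum>i<k. dcomm T (x * a i) o\<^sub>L dcomm T (b i))"
    unfolding 1(1) 1(3)[symmetric]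
    using 1(2) assms(2)
    by (simp add: bounded_bilinear.sum_right[OF bounded_bilinear_blinfun_compose]
        sum.distrib[symmetric] dcomm_mult blinfun_comp_simps blinfun_comp_assoc)
  moreover have "Rep T x o\<^sub>L \<omega> = (\<Sum>i<k. Rep T (x * a i) o\<^sub>L dcomm T (b i))"
    unfolding 1(3)[symmetric] using 1(2) assms(2)
    by (simp add: bounded_bilinear.sum_right[OF bounded_bilinear_blinfun_compose]
        rep_mult blinfun_comp_assoc)
  ultimately show ?thesis
    unfolding d_one_def using 1(2) assms(2)
    by (intro CollectI exI[of _ k] exI[of _ "\<lambda>i. x * a i"] exI[of _ b]) (auto simp: alg_mult)
qed

lemma d_one_uminus: "S \<in> d_one T \<omega> \<Longrightarrow> - S \<in> d_one T (- \<omega>)"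
  using d_one_rep_left[OF _ alg_uminus[OF alg_one], of S \<omega>]
  by (simp add: rep_uminus alg_one dcomm_uminus dcomm_one rep_one blinfun_comp_simps)

lemma d_one_diff: "S \<in> d_one T \<omega> \<Longrightarrow> S' \<in> d_one T \<eta> \<Longrightarrow> S - S' \<in> d_one T (\<omega> - \<eta>)"
  using d_one_plus[OF _ d_one_uminus, of S \<omega> S' \<eta>] by simp

lemma junk_subgroup: "add_subgroup (junk_two T)"
  using d_one_diff[of _ 0 _ 0] by (simp add: add_subgroup_def junk_two_def d_one_zero)

text \<open>Two representations of the same one-form differ by a representation of 0, and the values
  on those are the junk.\<close>

lemma d_one_coset:
  assumes "S \<in> d_one T \<omega>" shows "d_one T \<omega> = S +o junk_two T"
proof (intro Set.set_eqI iffI)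
  fix S' assume "S' \<in> d_one T \<omega>"
  from d_one_diff[OF this assms] show "S' \<in> S +o junk_two T"
    by (simp add: junk_two_def set_minus_plus[symmetric])
next
  fix S' assume "S' \<in> S +o junk_two T"
  then have "S' - S \<in> d_one T 0" by (simp add: junk_two_def set_minus_plus)
  from d_one_plus[OF assms this] show "S' \<in> d_one T \<omega>" by simp
qed

lemma d_one_ops: "S \<in> d_one T \<omega> \<Longrightarrow> S \<in> two_form_ops T"
  unfolding d_one_def two_form_ops_def
  by (auto intro!: span_sum two_form_op_comp[unfolded two_form_ops_def] one_form_dcomm)

lemma d_one_nonempty: "\<omega> \<in> one_forms T \<Longrightarrow> \<exists>S. S \<in> d_one T \<omega>"
  by (induction rule: one_form_induct) (blast intro: d_one_gen d_one_plus)+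

lemma d_one_in: "\<omega> \<in> one_forms T \<Longrightarrow> d_one T \<omega> \<in> two_forms T"
  using d_one_nonempty d_one_coset d_one_ops unfolding two_forms_def by blast

lemma d_one_add:
  assumes "\<omega> \<in> one_forms T" "\<eta> \<in> one_forms T"
  shows "d_one T (\<omega> + \<eta>) = d_one T \<omega> + d_one T \<eta>"
proof -
  obtain S S' where S: "S \<in> d_one T \<omega>" "S' \<in> d_one T \<eta>" using assms d_one_nonempty by blast
  show ?thesis
    unfolding d_one_coset[OF S(1)] d_one_coset[OF S(2)] d_one_coset[OF d_one_plus[OF S]]
    by (simp add: coset_add junk_subgroup)
qed

text \<open>This is \<open>d\<^sup>2 = 0\<close>: the representation \<open>1 [D, b]\<close>
  contributes \<open>[D, 1] [D, b] = 0\<close>.\<close>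

lemma d_one_dcomm:
  assumes "b \<in> Alg T" shows "d_one T (dcomm T b) = junk_two T"
proof -
  have "0 \<in> d_one T (dcomm T b)"
    using d_one_gen[OF alg_one assms]
    by (simp add: dcomm_one rep_one)
  then show ?thesis using d_one_coset by fastforce
qed

lemma junk_rep_left: "a \<in> Alg T \<Longrightarrow> S \<in> junk_two T \<Longrightarrow> Rep T a o\<^sub>L S \<in> junk_two T"
  using d_one_rep_left[of S 0 a] by (simp add: junk_two_def)

text \<open>Left multiplication may map junk onto a proper part of junk; the summand
  \<open>junk_two\<close> in \<open>two_forms_mod\<close> fills the image of a coset up to a full
  coset.\<close>

lemma two_forms_action:
  assumes "a \<in> Alg T"
  shows "snd (two_forms_mod T) a (S +o junk_two T) = (Rep T a o\<^sub>L S) +o junk_two T"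
proof -
  have "(\<lambda>S. Rep T a o\<^sub>L S) ` (S +o junk_two T) + junk_two T = (Rep T a o\<^sub>L S) +o junk_two T"
    (is "?L = ?R")
  proof
    show "?L \<subseteq> ?R"
    proof
      fix z assume "z \<in> ?L"
      then obtain j j' where j: "j \<in> junk_two T" "j' \<in> junk_two T"
        and z: "z = (Rep T a o\<^sub>L (S + j)) + j'"
        by (auto simp: set_plus_def elt_set_plus_def)
      have "z = (Rep T a o\<^sub>L S) + ((Rep T a o\<^sub>L j) + j')"
        by (simp add: z blinfun_comp_simps add.assoc)
      then show "z \<in> ?R"
        using j assms by (simp add: set_plus_intro2 add_subgroup_add junk_subgroup junk_rep_left)
    qed
    show "?R \<subseteq> ?L"
    proof
      fix z assume "z \<in> ?R"
      then obtain j where j: "j \<in> junk_two T" "z = (Rep T a o\<^sub>L S) + j"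
        by (auto simp: elt_set_plus_def)
      have "S + 0 \<in> S +o junk_two T"
        by (rule set_plus_intro2[OF add_subgroup_zero[OF junk_subgroup]])
      then show "z \<in> ?L" using j by (auto intro!: set_plus_intro)
    qed
  qed
  then show ?thesis by (simp add: two_forms_mod_def)
qed

lemma two_form_coset: "S \<in> two_form_ops T \<Longrightarrow> S +o junk_two T \<in> two_forms T"
  by (auto simp: two_forms_def)

lemma two_form_action_in: "a \<in> Alg T \<Longrightarrow> X \<in> two_forms T \<Longrightarrow> snd (two_forms_mod T) a X \<in> two_forms T"
  by (auto simp: two_forms_def two_forms_action intro: two_form_op_rep_left)

lemma two_form_add: "X \<in> two_forms T \<Longrightarrow> Y \<in> two_forms T \<Longrightarrow> X + Y \<in> two_forms T"
  by (auto simp: two_forms_def coset_add junk_subgroup intro: two_form_op_add)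

lemma d_one_rep:
  assumes "\<omega> \<in> one_forms T" "a \<in> Alg T"
  shows "d_one T (Rep T a o\<^sub>L \<omega>) = wedge T (dcomm T a) \<omega> + snd (two_forms_mod T) a (d_one T \<omega>)"
proof -
  obtain S where S: "S \<in> d_one T \<omega>" using assms d_one_nonempty by blast
  show ?thesis
    unfolding d_one_coset[OF S] d_one_coset[OF d_one_rep_left[OF S assms(2)]]
    using assms by (simp add: wedge_def two_forms_action coset_add junk_subgroup)
qed

lemma wedge_in: "\<omega> \<in> one_forms T \<Longrightarrow> \<eta> \<in> one_forms T \<Longrightarrow> wedge T \<omega> \<eta> \<in> two_forms T"
  by (simp add: wedge_def two_form_coset two_form_op_comp)

lemma wedge_add_left: "wedge T (\<omega> + \<omega>') \<eta> = wedge T \<omega> \<eta> + wedge T \<omega>' \<eta>"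
  and wedge_add_right: "wedge T \<omega> (\<eta> + \<eta>') = wedge T \<omega> \<eta> + wedge T \<omega> \<eta>'"
  by (simp_all add: wedge_def blinfun_comp_simps coset_add junk_subgroup)

lemma wedge_rep: "a \<in> Alg T \<Longrightarrow> wedge T (Rep T a o\<^sub>L \<omega>) \<eta> = snd (two_forms_mod T) a (wedge T \<omega> \<eta>)"
  by (simp add: wedge_def two_forms_action blinfun_comp_assoc)

end

section \<open>Extension of a connection to one-forms\<close>

lemma fst_one_forms_mod [simp]: "fst (one_forms_mod T) = one_forms T"
  and snd_one_forms_mod [simp]: "snd (one_forms_mod T) a \<omega> = Rep T a o\<^sub>L \<omega>"
  and fst_two_forms_mod [simp]: "fst (two_forms_mod T) = two_forms T"
  by (simp_all add: one_forms_mod_def two_forms_mod_def)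

locale spectral_module = spectral T
  for T :: "('a::cstar_algebra, 'h::chilbert_space) spectral_data" +
  fixes E :: "('a, 'm::ab_group_add) rmod"
  assumes E_subgroup: "add_subgroup (fst E)"
    and E_action: "m \<in> fst E \<Longrightarrow> a \<in> Alg T \<Longrightarrow> snd E m a \<in> fst E"
begin

sublocale one: tensor_pair "Alg T" E "one_forms_mod T"
  by unfold_locales
    (use one_form_zero in \<open>auto simp: E_subgroup E_action one_form_add one_form_rep_left\<close>)

sublocale two: tensor_pair "Alg T" E "two_forms_mod T"
  by unfold_locales
    (use d_one_in[OF one_form_zero] in
      \<open>auto simp: E_subgroup E_action two_form_add two_form_action_in\<close>)

abbreviation "E1 \<equiv> tensor (Alg T) E (one_forms_mod T)"
abbreviation "E2 \<equiv> tensor (Alg T) E (two_forms_mod T)"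
abbreviation "tens1 \<equiv> tens (Alg T) E (one_forms_mod T)"
abbreviation "tens2 \<equiv> tens (Alg T) E (two_forms_mod T)"

lemma tens_one_zero:
  assumes "m \<in> fst E" shows "tens1 m 0 = tensor_rel (Alg T) E (one_forms_mod T)"
  using one.tens_add_right[of m 0 0] assms
  by (intro one.tensor_cancel[of "tens1 m 0"]) (auto simp: one_form_zero one.tens_in)

text \<open>Since \<open>m \<otimes> a [D, b] = m a \<otimes> [D, b]\<close>, exact one-forms suffice as generators.\<close>

lemma tensor_one_induct [consumes 1, case_names dcomm add]:
  assumes "X \<in> E1"
    and tens: "\<And>m b. m \<in> fst E \<Longrightarrow> b \<in> Alg T \<Longrightarrow> P (tens1 m (dcomm T b))"
    and add: "\<And>Y Z. Y \<in> E1 \<Longrightarrow> Z \<in> E1 \<Longrightarrow> P Y \<Longrightarrow> P Z \<Longrightarrow> P (Y + Z)"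
  shows "P X"
  using assms(1)
proof (induction rule: one.tensor_induct)
  case (tens m \<omega>)
  then have "\<omega> \<in> one_forms T" by simp
  then show ?case
  proof (induction rule: one_form_induct)
    case (gen a b)
    have "P (tens1 (snd E m a) (dcomm T b))"
      using gen tens by (intro assms(2)) (auto simp: E_action)
    then show ?case
      using gen tens one.tens_balanced[of m a "dcomm T b"] by (simp add: one_form_dcomm)
  next
    case (add \<omega> \<eta>)
    then show ?case
      using tens by (simp add: one.tens_add_right assms(3) one.tens_in)
  qed
qed (rule add)

lemma
  assumes x: "x \<in> Alg T"
  shows right_mult_in: "X \<in> E1 \<Longrightarrow> right_mult T E X x \<in> E1"
    and right_mult_additive: "additive_on E1 (\<lambda>X. right_mult T E X x)"
    and right_mult_tens: "m \<in> fst E \<Longrightarrow> \<omega> \<in> one_forms T \<Longrightarrow>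
      right_mult T E (tens1 m \<omega>) x = tens1 m (\<omega> o\<^sub>L Rep T x)"
proof -
  let ?f = "\<lambda>\<xi> \<omega>. tens1 \<xi> (\<omega> o\<^sub>L Rep T x)"
  have f: "?f m \<omega> \<in> E1" if "m \<in> fst E" "\<omega> \<in> fst (one_forms_mod T)" for m \<omega>
    using that x by (auto intro!: one.tens_in one_form_rep_right)
  have "balanced_map (Alg T) E (one_forms_mod T) ?f"
    unfolding balanced_map_def additive_on_def using x
    by (auto simp: one.tens_add_left one.tens_add_right one_form_rep_right blinfun_comp_simps
        one.tens_balanced[simplified] blinfun_comp_assoc)
  note lift = tensor_lift_in[OF one.tensor_pair_axioms one.tensor_pair_axioms f this]
    tensor_lift_additive[OF one.tensor_pair_axioms one.tensor_pair_axioms f this]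
    tensor_lift_tens[OF one.tensor_pair_axioms one.tensor_pair_axioms f this]
  show "X \<in> E1 \<Longrightarrow> right_mult T E X x \<in> E1" "additive_on E1 (\<lambda>X. right_mult T E X x)"
    "m \<in> fst E \<Longrightarrow> \<omega> \<in> one_forms T \<Longrightarrow> right_mult T E (tens1 m \<omega>) x = tens1 m (\<omega> o\<^sub>L Rep T x)"
    unfolding right_mult_def by (use lift in auto)
qed

lemma
  assumes \<eta>: "\<eta> \<in> one_forms T"
  shows right_wedge_in: "X \<in> E1 \<Longrightarrow> right_wedge T E X \<eta> \<in> E2"
    and right_wedge_additive: "additive_on E1 (\<lambda>X. right_wedge T E X \<eta>)"
    and right_wedge_tens: "m \<in> fst E \<Longrightarrow> \<omega> \<in> one_forms T \<Longrightarrow>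
      right_wedge T E (tens1 m \<omega>) \<eta> = tens2 m (wedge T \<omega> \<eta>)"
proof -
  let ?f = "\<lambda>\<xi> \<omega>. tens2 \<xi> (wedge T \<omega> \<eta>)"
  have f: "?f m \<omega> \<in> E2" if "m \<in> fst E" "\<omega> \<in> fst (one_forms_mod T)" for m \<omega>
    using that \<eta> by (auto intro!: two.tens_in wedge_in)
  have "balanced_map (Alg T) E (one_forms_mod T) ?f"
    unfolding balanced_map_def additive_on_def using \<eta>
    by (auto simp: two.tens_add_left two.tens_add_right wedge_in wedge_add_left
        two.tens_balanced[simplified] wedge_rep)
  note lift = tensor_lift_in[OF one.tensor_pair_axioms two.tensor_pair_axioms f this]
    tensor_lift_additive[OF one.tensor_pair_axioms two.tensor_pair_axioms f this]
    tensor_lift_tens[OF one.tensor_pair_axioms two.tensor_pair_axioms f this]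
  show "X \<in> E1 \<Longrightarrow> right_wedge T E X \<eta> \<in> E2" "additive_on E1 (\<lambda>X. right_wedge T E X \<eta>)"
    "m \<in> fst E \<Longrightarrow> \<omega> \<in> one_forms T \<Longrightarrow> right_wedge T E (tens1 m \<omega>) \<eta> = tens2 m (wedge T \<omega> \<eta>)"
    unfolding right_wedge_def by (use lift in auto)
qed

lemma right_wedge_add_right:
  assumes "X \<in> E1" "\<eta> \<in> one_forms T" "\<eta>' \<in> one_forms T"
  shows "right_wedge T E X (\<eta> + \<eta>') = right_wedge T E X \<eta> + right_wedge T E X \<eta>'"
  using assms(1)
proof (induction rule: one.tensor_induct)
  case (tens m n)
  then show ?case
    using assms(2,3)
    by (simp add: right_wedge_tens one_form_add wedge_add_right two.tens_add_right wedge_in)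
next
  case (add Y Z)
  then show ?case
    using assms(2,3)
    by (simp add: additive_onD[OF right_wedge_additive] one_form_add add_ac)
qed

text \<open>Together with the Leibniz rule of a connection, this makes the extension below balanced
  over the algebra.\<close>

lemma right_wedge_right_mult:
  assumes "X \<in> E1" "\<eta> \<in> one_forms T" "a \<in> Alg T"
  shows "right_wedge T E (right_mult T E X a) \<eta> = right_wedge T E X (Rep T a o\<^sub>L \<eta>)"
  using assms(1)
proof (induction rule: one.tensor_induct)
  case (tens m n)
  then show ?case
    using assms(2,3)
    by (simp add: right_wedge_tens right_mult_tens one_form_rep_left one_form_rep_right wedge_def
        blinfun_comp_assoc)
next
  case (add Y Z)
  then show ?case
    using assms(2,3)
    by (simp add: additive_onD[OF right_wedge_additive] additive_onD[OF right_mult_additive]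
        one_form_rep_left right_mult_in)
qed

text \<open>Balancedness is the point. Compared with
  \<open>\<nabla>(m) a \<omega> + m \<otimes> a d \<omega>\<close>, the value at
  \<open>(m a, \<omega>)\<close> and the value at \<open>(m, a \<omega>)\<close> both contain the
  extra term \<open>m \<otimes> [D, a] \<omega>\<close>: the first gets it from the Leibniz rule of
  the connection, the second from that of \<open>d\<close>.\<close>

lemma
  assumes conn: "is_connection T E nabla"
  shows extend_connection_in: "X \<in> E1 \<Longrightarrow> extend_connection T E nabla X \<in> E2"
    and extend_connection_additive: "additive_on E1 (extend_connection T E nabla)"
    and extend_connection_tens: "m \<in> fst E \<Longrightarrow> \<omega> \<in> one_forms T \<Longrightarrow>
      extend_connection T E nabla (tens1 m \<omega>) = right_wedge T E (nabla m) \<omega> + tens2 m (d_one T \<omega>)"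
proof -
  have nabla_in: "nabla m \<in> E1" if "m \<in> fst E" for m
    using conn that by (auto simp: is_connection_def)
  have nabla_add: "nabla (m + m') = nabla m + nabla m'" if "m \<in> fst E" "m' \<in> fst E" for m m'
    using conn that by (auto simp: is_connection_def additive_on_def)
  have nabla_mult: "nabla (snd E m a) = right_mult T E (nabla m) a + tens1 m (dcomm T a)"
    if "m \<in> fst E" "a \<in> Alg T" for m a
    using conn that by (auto simp: is_connection_def)
  let ?f = "\<lambda>\<xi> \<omega>. right_wedge T E (nabla \<xi>) \<omega> + tens2 \<xi> (d_one T \<omega>)"
  have f: "?f m \<omega> \<in> E2" if "m \<in> fst E" "\<omega> \<in> fst (one_forms_mod T)" for m \<omega>
    using that by (auto intro!: two.tensor_add two.tens_in d_one_in right_wedge_in nabla_in)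
  have "?f (m + m') \<omega> = ?f m \<omega> + ?f m' \<omega>"
    if "m \<in> fst E" "m' \<in> fst E" "\<omega> \<in> one_forms T" for m m' \<omega>
    using that by (simp add: nabla_add nabla_in additive_onD[OF right_wedge_additive]
        two.tens_add_left d_one_in add_ac)
  moreover have "?f m (\<omega> + \<omega>') = ?f m \<omega> + ?f m \<omega>'"
    if "m \<in> fst E" "\<omega> \<in> one_forms T" "\<omega>' \<in> one_forms T" for m \<omega> \<omega>'
    using that by (simp add: nabla_in right_wedge_add_right d_one_add two.tens_add_right d_one_in add_ac)
  moreover have "?f (snd E m a) \<omega> = ?f m (Rep T a o\<^sub>L \<omega>)"
    if m: "m \<in> fst E" and a: "a \<in> Alg T" and \<omega>: "\<omega> \<in> one_forms T" for m a \<omega>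
  proof -
    have "right_wedge T E (nabla (snd E m a)) \<omega> =
        right_wedge T E (nabla m) (Rep T a o\<^sub>L \<omega>) + tens2 m (wedge T (dcomm T a) \<omega>)"
      using m a \<omega> by (simp add: nabla_mult additive_onD[OF right_wedge_additive] right_mult_in
          nabla_in one.tens_in one_form_dcomm right_wedge_right_mult right_wedge_tens)
    moreover have "tens2 (snd E m a) (d_one T \<omega>) = tens2 m (snd (two_forms_mod T) a (d_one T \<omega>))"
      using m a \<omega> by (simp add: two.tens_balanced d_one_in)
    moreover have "tens2 m (d_one T (Rep T a o\<^sub>L \<omega>)) =
        tens2 m (wedge T (dcomm T a) \<omega>) + tens2 m (snd (two_forms_mod T) a (d_one T \<omega>))"
      using m a \<omega> by (simp add: d_one_rep two.tens_add_right wedge_in one_form_dcomm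
          two_form_action_in d_one_in)
    ultimately show ?thesis by (simp add: add_ac)
  qed
  ultimately have "balanced_map (Alg T) E (one_forms_mod T) ?f"
    unfolding balanced_map_def additive_on_def by simp
  note lift = tensor_lift_in[OF one.tensor_pair_axioms two.tensor_pair_axioms f this]
    tensor_lift_additive[OF one.tensor_pair_axioms two.tensor_pair_axioms f this]
    tensor_lift_tens[OF one.tensor_pair_axioms two.tensor_pair_axioms f this]
  show "X \<in> E1 \<Longrightarrow> extend_connection T E nabla X \<in> E2" "additive_on E1 (extend_connection T E nabla)"
    "m \<in> fst E \<Longrightarrow> \<omega> \<in> one_forms T \<Longrightarrow>
      extend_connection T E nabla (tens1 m \<omega>) = right_wedge T E (nabla m) \<omega> + tens2 m (d_one T \<omega>)"
    unfolding extend_connection_def by (use lift in auto)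
qed

end

section \<open>The twisted action\<close>

locale covering =
  fixes G :: "'g monoid" (structure)
    and act :: "'g \<Rightarrow> 'b::cstar_algebra \<Rightarrow> 'b"
    and A :: "'b set"
    and \<rho> :: "'g \<Rightarrow> complex ^ 'n ^ 'n"
  assumes cover: "nc_covering A G act"
    and rho: "linear_representation G \<rho>"
begin

sublocale group G
  using cover by (simp add: nc_covering_def)

lemma finite_G: "finite (carrier G)"
  and act_one: "act \<one> a = a"
  and act_mult: "g \<in> carrier G \<Longrightarrow> h \<in> carrier G \<Longrightarrow> act (g \<otimes> h) a = act g (act h a)"
  and act_add: "g \<in> carrier G \<Longrightarrow> act g (a + b) = act g a + act g b"
  and act_times: "g \<in> carrier G \<Longrightarrow> act g (a * b) = act g a * act g b"
  and act_scaleC: "g \<in> carrier G \<Longrightarrow> act g (c *\<^sub>C a) = c *\<^sub>C act g a"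
  and act_star: "g \<in> carrier G \<Longrightarrow> act g (star a) = star (act g a)"
  and act_fixed: "g \<in> carrier G \<Longrightarrow> a \<in> A \<Longrightarrow> act g a = a"
  using cover by (simp_all add: nc_covering_def)

lemma card_G_pos: "card (carrier G) > 0"
  using finite_G one_closed by (auto simp: card_gt_0_iff)

lemma act_scaleR: "g \<in> carrier G \<Longrightarrow> act g (r *\<^sub>R a) = r *\<^sub>R act g a"
  by (simp add: scaleR_scaleC act_scaleC)

lemma act_zero: "g \<in> carrier G \<Longrightarrow> act g 0 = 0"
  using act_scaleR[of g 0 0] by simp

lemma act_sum: "g \<in> carrier G \<Longrightarrow> act g (sum f I) = (\<Sum>i\<in>I. act g (f i))"
  by (induction I rule: infinite_finite_induct) (simp_all add: act_add act_zero)

lemma sum_left_translate: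
  assumes "h \<in> carrier G" shows "(\<Sum>g\<in>carrier G. f (h \<otimes> g)) = (\<Sum>g\<in>carrier G. f g)"
  by (rule sum.reindex_bij_betw)
    (simp add: bij_betw_def inj_on_cmult[OF assms] surj_const_mult[OF assms])

lemma sum_right_translate:
  assumes "h \<in> carrier G" shows "(\<Sum>g\<in>carrier G. f (g \<otimes> h)) = (\<Sum>g\<in>carrier G. f g)"
proof (rule sum.reindex_bij_betw, rule bij_betw_byWitness[where f' = "\<lambda>g. g \<otimes> inv h"])
qed (use assms in \<open>auto simp: m_assoc\<close>)

abbreviation "tw \<equiv> twisted_action act \<rho>"
abbreviation "avg \<equiv> averaging G act \<rho>"

lemma twisted_nth: "tw g \<xi> $ i = (\<Sum>j\<in>UNIV. (\<rho> g $ i $ j) *\<^sub>C act g (\<xi> $ j))"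
  by (simp add: twisted_action_def)

lemma twisted_add: "g \<in> carrier G \<Longrightarrow> tw g (\<xi> + \<eta>) = tw g \<xi> + tw g \<eta>"
  by (simp add: vec_eq_iff twisted_nth act_add scaleC_add_right sum.distrib)

lemma twisted_scaleR: "g \<in> carrier G \<Longrightarrow> tw g (r *\<^sub>R \<xi>) = r *\<^sub>R tw g \<xi>"
  by (simp add: vec_eq_iff twisted_nth act_scaleR scaleR_sum_right)
    (simp add: scaleR_scaleC scaleC_scaleC mult.commute)

lemma twisted_zero: "g \<in> carrier G \<Longrightarrow> tw g 0 = 0"
  using twisted_scaleR[of g 0 0] by simp

lemma twisted_sum: "g \<in> carrier G \<Longrightarrow> tw g (sum f I) = (\<Sum>i\<in>I. tw g (f i))"
  by (induction I rule: infinite_finite_induct) (simp_all add: twisted_add twisted_zero)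

lemma twisted_mult:
  assumes "g \<in> carrier G" "h \<in> carrier G" shows "tw g (tw h \<xi>) = tw (g \<otimes> h) \<xi>"
proof -
  have "tw g (tw h \<xi>) $ i = tw (g \<otimes> h) \<xi> $ i" for i
  proof -
    have "tw g (tw h \<xi>) $ i =
        (\<Sum>j\<in>UNIV. \<Sum>k\<in>UNIV. (\<rho> g $ i $ j * \<rho> h $ j $ k) *\<^sub>C act (g \<otimes> h) (\<xi> $ k))"
      using assms
      by (simp add: twisted_nth act_sum act_scaleC act_mult scaleC_sum_right scaleC_scaleC)
    also have "\<dots> = (\<Sum>k\<in>UNIV. (\<Sum>j\<in>UNIV. \<rho> g $ i $ j * \<rho> h $ j $ k) *\<^sub>C act (g \<otimes> h) (\<xi> $ k))"
      by (subst sum.swap) (simp add: scaleC_sum_left)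
    also have "\<dots> = tw (g \<otimes> h) \<xi> $ i"
      using rho assms by (simp add: twisted_nth linear_representation_def matrix_matrix_mult_def)
    finally show ?thesis .
  qed
  then show ?thesis by (simp add: vec_eq_iff)
qed

text \<open>Factors fixed by \<open>G\<close> pass through the action, which makes the averaging
  idempotent linear over the fixed algebra.\<close>

lemma twisted_vec_rmult:
  "g \<in> carrier G \<Longrightarrow> x \<in> A \<Longrightarrow> tw g (vec_rmult \<xi> x) = vec_rmult (tw g \<xi>) x"
  by (simp add: vec_eq_iff twisted_nth vec_rmult_def act_times act_fixed mult_scaleC_left
      sum_distrib_right)

lemma averaging_add: "avg (\<xi> + \<eta>) = avg \<xi> + avg \<eta>"
  by (simp add: averaging_def twisted_add sum.distrib scaleR_add_right)

lemma averaging_sum: "avg (sum f I) = (\<Sum>i\<in>I. avg (f i))"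
  by (induction I rule: infinite_finite_induct)
    (simp_all add: averaging_add averaging_def[of _ _ _ 0] twisted_zero)

lemma averaging_vec_rmult: "x \<in> A \<Longrightarrow> avg (vec_rmult \<xi> x) = vec_rmult (avg \<xi>) x"
  by (simp add: averaging_def twisted_vec_rmult)
    (simp add: vec_eq_iff vec_rmult_def sum_distrib_right)

lemma averaging_invariant: "h \<in> carrier G \<Longrightarrow> tw h (avg \<xi>) = avg \<xi>"
  using sum_left_translate[of h "\<lambda>g. tw g \<xi>"]
  by (simp add: averaging_def twisted_scaleR twisted_sum twisted_mult)

lemma averaging_fixed: "(\<And>g. g \<in> carrier G \<Longrightarrow> tw g \<xi> = \<xi>) \<Longrightarrow> avg \<xi> = \<xi>"
  using card_G_pos by (simp add: averaging_def sum_constant_scaleR del: sum_constant)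

text \<open>These are the entries of the idempotent, seen as a matrix of operators on the algebra;
  \<open>Theta_coord_embed\<close> transports them to the Hilbert space.\<close>

lemma averaging_axis_nth:
  "avg (axis j a) $ i = (1 / real (card (carrier G))) *\<^sub>R (\<Sum>g\<in>carrier G. (\<rho> g $ i $ j) *\<^sub>C act g a)"
proof -
  have "tw g (axis j a) $ i = (\<rho> g $ i $ j) *\<^sub>C act g a" if "g \<in> carrier G" for g
  proof -
    have "tw g (axis j a) $ i = (\<Sum>k\<in>UNIV. if k = j then (\<rho> g $ i $ j) *\<^sub>C act g a else 0)"
      unfolding twisted_nth using that by (intro sum.cong) (auto simp: axis_def act_zero)
    then show ?thesis by simp
  qed
  then show ?thesis by (simp add: averaging_def)
qed

end

section \<open>The invariant module and its connection\<close>

text \<open>The setting for projectivity and the Leibniz rule. The Hilbert space action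
  \<open>U\<close> and the degree-two identification join in \<open>equivariant_lift\<close>, where
  flatness is proved.\<close>

locale covering_lift = covering G act "closure (Alg T)" \<rho>
  for G :: "'g monoid" (structure)
    and act :: "'g \<Rightarrow> 'b::cstar_algebra \<Rightarrow> 'b"
    and T :: "('b, 'h::chilbert_space) spectral_data"
    and \<rho> :: "'g \<Rightarrow> complex ^ 'n ^ 'n" +
  fixes T' :: "('b, 'k::chilbert_space) spectral_data"
    and \<Theta> :: "('b \<times> ('h \<Rightarrow>\<^sub>L 'h) \<Rightarrow>\<^sub>0 int) set \<Rightarrow> ('k \<Rightarrow>\<^sub>L 'k)"
  assumes triple: "spectral_triple T" and triple': "spectral_triple T'"
    and act_alg: "g \<in> carrier G \<Longrightarrow> a \<in> Alg T' \<Longrightarrow> act g a \<in> Alg T'"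
    and alg_subset: "Alg T \<subseteq> Alg T'"
    and iso: "one_forms_iso T T' \<Theta>"
begin

sublocale S: spectral T by unfold_locales (rule triple)
sublocale S': spectral T' by unfold_locales (rule triple')

abbreviation BM :: "('b, 'b) rmod" where "BM \<equiv> (Alg T', (*))"
abbreviation FM :: "('b, 'b ^ 'n) rmod" where "FM \<equiv> free_mod T'"
abbreviation EM :: "('b, 'b ^ 'n) rmod" where "EM \<equiv> invariant_mod G act T' \<rho>"

lemma alg': "a \<in> Alg T \<Longrightarrow> a \<in> Alg T'" using alg_subset by blast

lemma fst_FM: "\<xi> \<in> fst FM \<longleftrightarrow> (\<forall>i. \<xi> $ i \<in> Alg T')"
  by (simp add: free_mod_def)

lemma snd_FM [simp]: "snd FM = vec_rmult"
  by (simp add: free_mod_def)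

lemma fst_EM: "\<xi> \<in> fst EM \<longleftrightarrow> \<xi> \<in> fst FM \<and> (\<forall>g\<in>carrier G. tw g \<xi> = \<xi>)"
  by (simp add: invariant_mod_def)

lemma snd_EM [simp]: "snd EM = vec_rmult"
  by (simp add: invariant_mod_def)

lemma vec_rmult_nth [simp]: "vec_rmult \<xi> x $ i = \<xi> $ i * x"
  by (simp add: vec_rmult_def)

lemma FM_subgroup: "add_subgroup (fst FM)"
  using S'.alg_subgroup by (auto simp: add_subgroup_def fst_FM)

lemma EM_subgroup: "add_subgroup (fst EM)"
proof -
  have "tw g (\<xi> - \<eta>) = tw g \<xi> - tw g \<eta>" if "g \<in> carrier G" for g \<xi> \<eta>
    using twisted_add[OF that, of "\<xi> - \<eta>" \<eta>] by (simp add: eq_diff_eq)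
  then show ?thesis
    using FM_subgroup by (auto simp: add_subgroup_def fst_EM twisted_zero)
qed

lemma act_fixed_alg: "x \<in> Alg T \<Longrightarrow> x \<in> closure (Alg T)"
  using closure_subset by blast

text \<open>\<open>FM\<close> enters twice: over \<open>\<A>'\<close> as the home of the trivial
  connection, over \<open>\<A>\<close> as the target of \<open>change_base\<close>.
  \<open>BM\<close> is \<open>\<A>'\<close> as a right \<open>\<A>\<close>-module, where coordinates
  take their values.\<close>

sublocale B: spectral_module T BM
  by unfold_locales (auto simp: S'.alg_subgroup S'.alg_mult alg')

sublocale F: spectral_module T FM
  by unfold_locales (auto simp: FM_subgroup fst_FM S'.alg_mult alg')

sublocale F': spectral_module T' FM
  by unfold_locales (auto simp: FM_subgroup fst_FM S'.alg_mult)

sublocale E: spectral_module T EM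
  by unfold_locales
    (auto simp: EM_subgroup fst_EM fst_FM S'.alg_mult alg' twisted_vec_rmult act_fixed_alg)

lemma averaging_in:
  assumes "\<xi> \<in> fst FM" shows "avg \<xi> \<in> fst EM"
proof -
  have "avg \<xi> $ i \<in> Alg T'" for i
    using assms by (simp add: averaging_def twisted_nth fst_FM S'.alg_scaleR S'.alg_scaleC
        S'.alg_sum act_alg)
  then show ?thesis by (simp add: fst_EM fst_FM averaging_invariant)
qed

lemma averaging_EM: "\<xi> \<in> fst EM \<Longrightarrow> avg \<xi> = \<xi>"
  by (rule averaging_fixed) (simp add: fst_EM)

lemma axis_in: "a \<in> Alg T' \<Longrightarrow> axis i a \<in> fst FM"
  by (auto simp: fst_FM axis_def S'.alg_zero)

lemma axis_add: "axis i (a + b) = axis i a + (axis i b :: 'b ^ 'n)"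
  by (simp add: vec_eq_iff axis_def)

lemma vec_rmult_axis: "vec_rmult (axis i a) x = (axis i (a * x) :: 'b ^ 'n)"
  by (simp add: vec_eq_iff axis_def)

lemma sum_axis: "(\<Sum>i\<in>UNIV. axis i (\<xi> $ i)) = (\<xi> :: 'b ^ 'n)"
  by (simp add: vec_eq_iff axis_def if_distrib cong: if_cong)

text \<open>If \<open>\<A>'\<close> is a summand of \<open>\<A>\<^sup>k\<close>, then
  \<open>\<A>'\<^sup>n\<close> is a summand of the free module of rank \<open>n * k\<close>, and
  averaging is an \<open>\<A>\<close>-linear retraction of \<open>\<A>'\<^sup>n\<close> onto
  \<open>E\<close>.\<close>

lemma fg_projective_EM:
  assumes "fg_projective (Alg T) BM"
  shows "fg_projective (Alg T) EM"
proof -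
  obtain k i p where ip: "i \<in> fst BM \<rightarrow> free_rmod (Alg T) k"
     "\<forall>x\<in>fst BM. \<forall>y\<in>fst BM. \<forall>j. i (x + y) j = i x j + i y j"
     "\<forall>x\<in>fst BM. \<forall>r\<in>Alg T. \<forall>j. i (snd BM x r) j = i x j * r"
     "p \<in> free_rmod (Alg T) k \<rightarrow> fst BM"
     "\<forall>v\<in>free_rmod (Alg T) k. \<forall>w\<in>free_rmod (Alg T) k. p (\<lambda>j. v j + w j) = p v + p w"
     "\<forall>v\<in>free_rmod (Alg T) k. \<forall>r\<in>Alg T. p (\<lambda>j. v j * r) = snd BM (p v) r"
     "\<forall>x\<in>fst BM. p (i x) = x"
    using assms unfolding fg_projective_def by (elim exE conjE)
  have i: "i x \<in> free_rmod (Alg T) k" "i (x + y) j = i x j + i y j"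
    if "x \<in> Alg T'" "y \<in> Alg T'" for x y j
    using ip(1,2) that by auto
  have i_mult: "i (x * r) j = i x j * r" if "x \<in> Alg T'" "r \<in> Alg T" for x r j
    using ip(3) that by simp
  have p: "p v \<in> Alg T'" "p (\<lambda>j. v j + w j) = p v + p w"
    if "v \<in> free_rmod (Alg T) k" "w \<in> free_rmod (Alg T) k" for v w
    using ip(4,5) that by auto
  have p_mult: "p (\<lambda>j. v j * r) = p v * r" if "v \<in> free_rmod (Alg T) k" "r \<in> Alg T" for v r
    using ip(6) that by simp
  have pi: "p (i x) = x" if "x \<in> Alg T'" for x
    using ip(7) that by simp
  define N where "N = CARD('n)"
  obtain e :: "nat \<Rightarrow> 'n" where e: "bij_betw e {0..<N} UNIV"
    using ex_bij_betw_nat_finite[of "UNIV :: 'n set"] by (auto simp: N_def)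
  define e' where "e' = inv_into {0..<N} e"
  have e': "e' m < N" "e (e' m) = m" for m
    using e bij_betw_inv_into_right[OF e, of m] bij_betw_imp_surj_on[OF e]
      inv_into_into[of m e "{0..<N}"] by (auto simp: e'_def)
  \<comment> \<open>Coordinate \<open>m\<close> occupies the block of \<open>k\<close> entries
    starting at \<open>e' m * k\<close>: \<open>I\<close> concatenates the blocks,
    \<open>s v m\<close> cuts one out.\<close>
  define I where "I \<xi> j = (if j < N * k then i (\<xi> $ e (j div k)) (j mod k) else 0)" for \<xi> :: "'b ^ 'n" and j
  define s where "s v m = (\<lambda>j. if j < k then v (e' m * k + j) else 0)" for v :: "nat \<Rightarrow> 'b" and m
  define P where "P v = avg (\<chi> m. p (s v m))" for v
  have idx: "e' m * k + j < N * k" if "j < k" for m j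
  proof -
    have "e' m * k + j < Suc (e' m) * k" using that by simp
    also have "\<dots> \<le> N * k" using e'(1)[of m] by (intro mult_le_mono1) simp
    finally show ?thesis .
  qed
  have s: "s v m \<in> free_rmod (Alg T) k" if "v \<in> free_rmod (Alg T) (N * k)" for v m
    using that idx by (auto simp: free_rmod_def s_def)
  have sI: "s (I \<xi>) m = i (\<xi> $ m)" if "\<xi> \<in> fst EM" for \<xi> m
  proof
    fix j
    show "s (I \<xi>) m j = i (\<xi> $ m) j"
    proof (cases "j < k")
      case True
      then have "(e' m * k + j) div k = e' m" "(e' m * k + j) mod k = j" by simp_all
      then show ?thesis using True idx[OF True] by (simp add: s_def I_def e')
    next
      case False
      then show ?thesis using i(1)[of "\<xi> $ m" "\<xi> $ m"] that
        by (simp add: s_def free_rmod_def fst_EM fst_FM)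
    qed
  qed
  have I_in: "I \<xi> \<in> free_rmod (Alg T) (N * k)" if "\<xi> \<in> fst EM" for \<xi>
  proof -
    \<comment> \<open>For \<open>k = 0\<close> no \<open>j\<close> satisfies the bound; otherwise
      \<open>j mod k < k\<close>.\<close>
    have "i (\<xi> $ e (j div k)) (j mod k) \<in> Alg T" if "j < N * k" for j
      using i(1)[of "\<xi> $ e (j div k)" "\<xi> $ e (j div k)"] \<open>\<xi> \<in> fst EM\<close> that
      by (cases "k = 0") (auto simp: free_rmod_def fst_EM fst_FM)
    then show ?thesis by (auto simp: free_rmod_def I_def)
  qed
  have P_in: "P v \<in> fst EM" if "v \<in> free_rmod (Alg T) (N * k)" for v
    using that unfolding P_def by (intro averaging_in) (simp add: fst_FM p(1)[OF s s])
  have P_add: "P (\<lambda>j. v j + w j) = P v + P w"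
    if "v \<in> free_rmod (Alg T) (N * k)" "w \<in> free_rmod (Alg T) (N * k)" for v w
  proof -
    have "s (\<lambda>j. v j + w j) m = (\<lambda>j. s v m j + s w m j)" for m by (auto simp: s_def)
    then have "(\<chi> m. p (s (\<lambda>j. v j + w j) m)) = (\<chi> m. p (s v m)) + (\<chi> m. p (s w m))"
      using that by (simp add: vec_eq_iff p s)
    then show ?thesis by (simp add: P_def averaging_add)
  qed
  have P_mult: "P (\<lambda>j. v j * r) = vec_rmult (P v) r"
    if "v \<in> free_rmod (Alg T) (N * k)" "r \<in> Alg T" for v r
  proof -
    have "s (\<lambda>j. v j * r) m = (\<lambda>j. s v m j * r)" for m by (auto simp: s_def)
    then have "(\<chi> m. p (s (\<lambda>j. v j * r) m)) = vec_rmult (\<chi> m. p (s v m)) r"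
      using that by (simp add: vec_eq_iff p_mult s)
    then show ?thesis using that by (simp add: P_def averaging_vec_rmult act_fixed_alg)
  qed
  have PI: "P (I \<xi>) = \<xi>" if "\<xi> \<in> fst EM" for \<xi>
  proof -
    have "(\<chi> m. p (s (I \<xi>) m)) = \<xi>"
      using that by (simp add: vec_eq_iff sI pi fst_EM fst_FM)
    then show ?thesis using that by (simp add: P_def averaging_EM)
  qed
  have I_add: "I (\<xi> + \<eta>) j = I \<xi> j + I \<eta> j" if "\<xi> \<in> fst EM" "\<eta> \<in> fst EM" for \<xi> \<eta> j
    using that by (simp add: I_def i fst_EM fst_FM)
  have I_mult: "I (vec_rmult \<xi> r) j = I \<xi> j * r" if "\<xi> \<in> fst EM" "r \<in> Alg T" for \<xi> r j
    using that by (simp add: I_def i_mult fst_EM fst_FM)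
  show ?thesis
    unfolding fg_projective_def snd_EM
    using I_in I_add I_mult P_in P_add P_mult PI
    by (intro exI[of _ "N * k"] exI[of _ I] exI[of _ P]) auto
qed

text \<open>\<open>coord i = \<pi>\<^sub>i \<otimes> 1\<close> and \<open>embed i = (e \<circ> \<iota>\<^sub>i) \<otimes> 1\<close>, where \<open>\<pi>\<^sub>i\<close> and \<open>\<iota>\<^sub>i\<close> are the projections and
  injections of \<open>\<A>'\<^sup>n\<close>.\<close>

definition coord :: "('b, 'c::plus) lmod \<Rightarrow> 'n \<Rightarrow> (('b ^ 'n) \<times> 'c \<Rightarrow>\<^sub>0 int) set \<Rightarrow> ('b \<times> 'c \<Rightarrow>\<^sub>0 int) set" where
  "coord N i = tensor_map (Alg T) EM BM N (\<lambda>\<xi>. \<xi> $ i)"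

definition embed :: "('b, 'c::plus) lmod \<Rightarrow> 'n \<Rightarrow> ('b \<times> 'c \<Rightarrow>\<^sub>0 int) set \<Rightarrow> (('b ^ 'n) \<times> 'c \<Rightarrow>\<^sub>0 int) set" where
  "embed N i = tensor_map (Alg T) BM EM N (\<lambda>a. avg (axis i a))"

lemma hom_nth: "rmod_hom (Alg T) EM BM (\<lambda>\<xi>. \<xi> $ i)"
  by (auto simp: rmod_hom_def additive_on_def fst_EM fst_FM)

lemma hom_axis: "rmod_hom (Alg T) BM EM (\<lambda>a. avg (axis i a))"
  by (auto simp: rmod_hom_def additive_on_def averaging_in axis_in axis_add averaging_add
      averaging_vec_rmult[symmetric] act_fixed_alg vec_rmult_axis)

lemma hom_avg: "rmod_hom (Alg T) FM EM avg"
  by (auto simp: rmod_hom_def additive_on_def averaging_in averaging_add averaging_vec_rmult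
      act_fixed_alg)

lemma hom_vec: "\<xi> \<in> fst FM \<Longrightarrow> rmod_hom (Alg T) BM FM (vec_rmult \<xi>)"
  by (auto simp: rmod_hom_def additive_on_def fst_FM S'.alg_mult vec_eq_iff distrib_left mult.assoc)

lemma hom_mult: "b \<in> Alg T' \<Longrightarrow> rmod_hom (Alg T) BM BM ((*) b)"
  by (auto simp: rmod_hom_def additive_on_def S'.alg_mult distrib_left mult.assoc)

lemma
  assumes N: "tensor_pair (Alg T) EM N" "tensor_pair (Alg T) BM N"
  shows coord_in: "X \<in> tensor (Alg T) EM N \<Longrightarrow> coord N i X \<in> tensor (Alg T) BM N"
    and coord_additive: "additive_on (tensor (Alg T) EM N) (coord N i)"
    and coord_tens: "\<xi> \<in> fst EM \<Longrightarrow> n \<in> fst N \<Longrightarrow>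
      coord N i (tens (Alg T) EM N \<xi> n) = tens (Alg T) BM N (\<xi> $ i) n"
    and embed_in: "Y \<in> tensor (Alg T) BM N \<Longrightarrow> embed N i Y \<in> tensor (Alg T) EM N"
    and embed_additive: "additive_on (tensor (Alg T) BM N) (embed N i)"
    and embed_tens: "a \<in> Alg T' \<Longrightarrow> n \<in> fst N \<Longrightarrow>
      embed N i (tens (Alg T) BM N a n) = tens (Alg T) EM N (avg (axis i a)) n"
  using tensor_map_in[OF N(1) N(2) hom_nth] tensor_map_additive[OF N(1) N(2) hom_nth]
    tensor_map_tens[OF N(1) N(2) hom_nth] tensor_map_in[OF N(2) N(1) hom_axis]
    tensor_map_additive[OF N(2) N(1) hom_axis] tensor_map_tens[OF N(2) N(1) hom_axis]
  by (auto simp: coord_def embed_def)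

lemma sum_averaging_axis: "\<xi> \<in> fst EM \<Longrightarrow> (\<Sum>i\<in>UNIV. avg (axis i (\<xi> $ i))) = \<xi>"
  by (simp add: averaging_sum[symmetric] sum_axis averaging_EM)

lemma sum_tens_averaging_axis:
  assumes N: "tensor_pair (Alg T) EM N" and "\<xi> \<in> fst EM" "n \<in> fst N"
  shows "(\<Sum>i\<in>UNIV. tens (Alg T) EM N (avg (axis i (\<xi> $ i))) n) = tens (Alg T) EM N \<xi> n"
proof -
  have "avg (axis i (\<xi> $ i)) \<in> fst EM" for i
    using assms(2) by (intro averaging_in axis_in) (simp add: fst_EM fst_FM)
  then show ?thesis
    using tensor_pair.tens_sum_left[OF N, of UNIV "\<lambda>i. avg (axis i (\<xi> $ i))" n] assms(2,3)
    by (simp add: sum_averaging_axis)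
qed

text \<open>On elementary tensors this is
  \<open>\<Sum>\<^sub>i e \<iota>\<^sub>i \<pi>\<^sub>i = e\<close>, and \<open>e\<close> is the
  identity on \<open>E\<close>. It exhibits \<open>E \<otimes> N\<close> as a summand of
  \<open>n\<close> copies of \<open>\<A>' \<otimes> N\<close>.\<close>

lemma sum_embed_coord:
  assumes N: "tensor_pair (Alg T) EM N" "tensor_pair (Alg T) BM N"
    and "X \<in> tensor (Alg T) EM N"
  shows "(\<Sum>i\<in>UNIV. embed N i (coord N i X)) = X"
  using assms(3)
proof (induction rule: tensor_pair.tensor_induct[OF N(1), consumes 1, case_names tens add])
  case (tens \<xi> n)
  then show ?case
    by (simp add: coord_tens[OF N] embed_tens[OF N] sum_tens_averaging_axis N(1) fst_EM fst_FM)
next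
  case (add Y Z)
  then show ?case
    by (simp add: additive_onD[OF coord_additive[OF N]] additive_onD[OF embed_additive[OF N]]
        coord_in[OF N] sum.distrib)
qed

lemma tensor_eq_relI:
  assumes N: "tensor_pair (Alg T) EM N" "tensor_pair (Alg T) BM N"
    and X: "X \<in> tensor (Alg T) EM N" "\<And>i. coord N i X = tensor_rel (Alg T) BM N"
  shows "X = tensor_rel (Alg T) EM N"
proof -
  let ?Z = "tensor_rel (Alg T) EM N"
  have Z: "?Z \<in> tensor (Alg T) EM N" by (rule tensor_pair.rel_in[OF N(1)])
  have "coord N i ?Z = tensor_rel (Alg T) BM N" for i
    by (rule tensor_pair.additive_on_rel[OF N(1) N(2) coord_additive[OF N] coord_in[OF N]])
  then show ?thesis
    \<comment> \<open>\<open>X\<close> and the zero coset are rebuilt from the same coordinates,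
      hence coincide; this replaces passing to a difference.\<close>
    using sum_embed_coord[OF N X(1)] sum_embed_coord[OF N Z] X(2) by simp
qed

abbreviation "N1 \<equiv> one_forms_mod T"
abbreviation "N2 \<equiv> two_forms_mod T"

lemmas coord1_in = coord_in[OF E.one.tensor_pair_axioms B.one.tensor_pair_axioms]
lemmas coord1_additive = coord_additive[OF E.one.tensor_pair_axioms B.one.tensor_pair_axioms]
lemmas coord1_tens = coord_tens[OF E.one.tensor_pair_axioms B.one.tensor_pair_axioms, simplified]
lemmas embed1_in = embed_in[OF E.one.tensor_pair_axioms B.one.tensor_pair_axioms]
lemmas embed1_additive = embed_additive[OF E.one.tensor_pair_axioms B.one.tensor_pair_axioms]
lemmas embed1_tens = embed_tens[OF E.one.tensor_pair_axioms B.one.tensor_pair_axioms, simplified]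
lemmas coord2_in = coord_in[OF E.two.tensor_pair_axioms B.two.tensor_pair_axioms]
lemmas coord2_additive = coord_additive[OF E.two.tensor_pair_axioms B.two.tensor_pair_axioms]
lemmas coord2_tens = coord_tens[OF E.two.tensor_pair_axioms B.two.tensor_pair_axioms, simplified]

section \<open>Bimodule linearity of the degree-one identification\<close>

lemma Theta_bij: "bij_betw \<Theta> B.E1 (one_forms T')"
  and Theta_additive: "additive_on B.E1 \<Theta>"
  using iso by (simp_all add: one_forms_iso_def Let_def)

lemma Theta_dcomm:
  assumes "a \<in> Alg T'" "c \<in> Alg T" shows "\<Theta> (B.tens1 a (dcomm T c)) = Rep T' a o\<^sub>L dcomm T' c"
proof -
  have "\<Theta> (B.tens1 a (Rep T 1 o\<^sub>L dcomm T c)) = Rep T' (a * 1) o\<^sub>L dcomm T' c"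
    using iso assms S.alg_one unfolding one_forms_iso_def Let_def by blast
  then show ?thesis by (simp add: S.rep_one)
qed

lemma Theta_gen:
  assumes "a \<in> Alg T'" "b \<in> Alg T" "c \<in> Alg T"
  shows "\<Theta> (B.tens1 a (Rep T b o\<^sub>L dcomm T c)) = Rep T' a o\<^sub>L (Rep T' b o\<^sub>L dcomm T' c)"
proof -
  have "\<Theta> (B.tens1 a (Rep T b o\<^sub>L dcomm T c)) = Rep T' (a * b) o\<^sub>L dcomm T' c"
    using iso assms unfolding one_forms_iso_def Let_def by blast
  then show ?thesis using assms by (simp add: S'.rep_mult alg' blinfun_comp_assoc)
qed

lemma Theta_add: "X \<in> B.E1 \<Longrightarrow> Y \<in> B.E1 \<Longrightarrow> \<Theta> (X + Y) = \<Theta> X + \<Theta> Y"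
  by (rule additive_onD[OF Theta_additive])

definition Thi where "Thi = inv_into B.E1 \<Theta>"

lemma Thi_in: "\<omega> \<in> one_forms T' \<Longrightarrow> Thi \<omega> \<in> B.E1"
  using Theta_bij by (auto simp: Thi_def bij_betw_def intro: inv_into_into)

lemma Theta_Thi: "\<omega> \<in> one_forms T' \<Longrightarrow> \<Theta> (Thi \<omega>) = \<omega>"
  using Theta_bij by (auto simp: Thi_def bij_betw_inv_into_right)

lemma Theta_in: "X \<in> B.E1 \<Longrightarrow> \<Theta> X \<in> one_forms T'"
  using Theta_bij by (auto simp: bij_betw_def)

lemma Thi_eqI: "X \<in> B.E1 \<Longrightarrow> \<Theta> X = \<omega> \<Longrightarrow> Thi \<omega> = X"
  using Theta_bij by (auto simp: Thi_def bij_betw_inv_into_left)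

lemma Thi_add: "\<omega> \<in> one_forms T' \<Longrightarrow> \<eta> \<in> one_forms T' \<Longrightarrow> Thi (\<omega> + \<eta>) = Thi \<omega> + Thi \<eta>"
  by (rule Thi_eqI) (simp_all add: B.one.tensor_add Thi_in Theta_add Theta_Thi)

text \<open>The definition of \<open>one_forms_iso\<close> mentions no right action, but the Leibniz
  rule forces it: \<open>a \<otimes> [D, c] x = a \<otimes> [D, c x] - a \<otimes> c [D, x]\<close>,
  and \<open>D'\<close> obeys the same rule.\<close>

lemma Theta_right_mult:
  assumes "X \<in> B.E1" "x \<in> Alg T" shows "\<Theta> (right_mult T BM X x) = \<Theta> X o\<^sub>L Rep T' x"
  using assms(1)
proof (induction rule: B.tensor_one_induct)
  case (dcomm a c)
  have a: "a \<in> Alg T'" using dcomm by simp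
  \<comment> \<open>Stated as a sum because cosets cannot be subtracted; the difference is formed
    after applying \<open>\<Theta>\<close>, among operators.\<close>
  have "B.tens1 a (dcomm T (c * x)) =
      B.tens1 a (dcomm T c o\<^sub>L Rep T x) + B.tens1 a (Rep T c o\<^sub>L dcomm T x)"
    using dcomm assms(2) by (simp add: S.dcomm_mult B.one.tens_add_right S.one_form_rep_right
        S.one_form_dcomm S.one_form_gen)
  then have "\<Theta> (B.tens1 a (dcomm T (c * x))) =
      \<Theta> (B.tens1 a (dcomm T c o\<^sub>L Rep T x)) + \<Theta> (B.tens1 a (Rep T c o\<^sub>L dcomm T x))"
    using dcomm assms(2) by (simp add: Theta_add B.one.tens_in S.one_form_rep_right
        S.one_form_dcomm S.one_form_gen)
  then have "\<Theta> (B.tens1 a (dcomm T c o\<^sub>L Rep T x)) = (Rep T' a o\<^sub>L dcomm T' c) o\<^sub>L Rep T' x"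
    using dcomm assms(2)
    by (simp add: Theta_gen Theta_dcomm[OF a] S.alg_mult S'.dcomm_mult alg' blinfun_comp_simps
        blinfun_comp_assoc)
  then show ?case
    using dcomm assms(2) by (simp add: B.right_mult_tens S.one_form_dcomm Theta_dcomm)
next
  case (add Y Z)
  then show ?case
    using assms(2) by (simp add: additive_onD[OF B.right_mult_additive] B.right_mult_in Theta_add
        blinfun_comp_simps)
qed

definition left_mult where "left_mult b = tensor_map (Alg T) BM BM N1 ((*) b)"

lemma
  assumes "b \<in> Alg T'"
  shows left_mult_in: "X \<in> B.E1 \<Longrightarrow> left_mult b X \<in> B.E1"
    and left_mult_additive: "additive_on B.E1 (left_mult b)"
    and left_mult_tens: "a \<in> Alg T' \<Longrightarrow> \<omega> \<in> one_forms T \<Longrightarrow>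
      left_mult b (B.tens1 a \<omega>) = B.tens1 (b * a) \<omega>"
  using tensor_map_in[OF B.one.tensor_pair_axioms B.one.tensor_pair_axioms hom_mult[OF assms]]
    tensor_map_additive[OF B.one.tensor_pair_axioms B.one.tensor_pair_axioms hom_mult[OF assms]]
    tensor_map_tens[OF B.one.tensor_pair_axioms B.one.tensor_pair_axioms hom_mult[OF assms]]
  by (auto simp: left_mult_def)

text \<open>\<open>change_base\<close> is balanced over \<open>\<A>'\<close> because
  \<open>\<Theta>\<close>, and so its inverse, respects this left action.\<close>

lemma Theta_left_mult:
  assumes "X \<in> B.E1" "b \<in> Alg T'" shows "\<Theta> (left_mult b X) = Rep T' b o\<^sub>L \<Theta> X"
  using assms(1)
proof (induction rule: B.tensor_one_induct)
  case (dcomm a c)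
  then show ?case
    using assms(2) by (simp add: left_mult_tens S.one_form_dcomm Theta_dcomm S'.alg_mult S'.rep_mult
        blinfun_comp_assoc)
next
  case (add Y Z)
  then show ?case
    using assms(2) by (simp add: additive_onD[OF left_mult_additive] left_mult_in Theta_add
        blinfun_comp_simps)
qed

lemma Thi_rep_left:
  "\<omega> \<in> one_forms T' \<Longrightarrow> b \<in> Alg T' \<Longrightarrow> Thi (Rep T' b o\<^sub>L \<omega>) = left_mult b (Thi \<omega>)"
  by (rule Thi_eqI) (simp_all add: left_mult_in Thi_in Theta_left_mult Theta_Thi)

text \<open>The second identification in \<open>change_base\<close>,
  \<open>a \<otimes> \<omega> \<mapsto> \<xi> a \<otimes> \<omega>\<close>, for a fixed
  \<open>\<xi>\<close>.\<close>

definition insert_vec :: "'b ^ 'n \<Rightarrow> ('b \<times> ('h \<Rightarrow>\<^sub>L 'h) \<Rightarrow>\<^sub>0 int) set \<Rightarrow> (('b ^ 'n) \<times> ('h \<Rightarrow>\<^sub>L 'h) \<Rightarrow>\<^sub>0 int) set"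
  where "insert_vec \<xi> = tensor_map (Alg T) BM FM N1 (vec_rmult \<xi>)"

lemma
  assumes "\<xi> \<in> fst FM"
  shows insert_vec_in: "X \<in> B.E1 \<Longrightarrow> insert_vec \<xi> X \<in> F.E1"
    and insert_vec_additive: "additive_on B.E1 (insert_vec \<xi>)"
    and insert_vec_tens: "a \<in> Alg T' \<Longrightarrow> \<omega> \<in> one_forms T \<Longrightarrow>
      insert_vec \<xi> (B.tens1 a \<omega>) = F.tens1 (vec_rmult \<xi> a) \<omega>"
  using tensor_map_in[OF B.one.tensor_pair_axioms F.one.tensor_pair_axioms hom_vec[OF assms]]
    tensor_map_additive[OF B.one.tensor_pair_axioms F.one.tensor_pair_axioms hom_vec[OF assms]]
    tensor_map_tens[OF B.one.tensor_pair_axioms F.one.tensor_pair_axioms hom_vec[OF assms]]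
  by (auto simp: insert_vec_def)

lemma vec_rmult_in: "\<xi> \<in> fst FM \<Longrightarrow> b \<in> Alg T' \<Longrightarrow> vec_rmult \<xi> b \<in> fst FM"
  by (simp add: fst_FM S'.alg_mult)

lemma insert_vec_add:
  assumes "X \<in> B.E1" "\<xi> \<in> fst FM" "\<eta> \<in> fst FM"
  shows "insert_vec (\<xi> + \<eta>) X = insert_vec \<xi> X + insert_vec \<eta> X"
  using assms(1)
proof (induction rule: B.one.tensor_induct)
  case (tens a \<omega>)
  have "vec_rmult (\<xi> + \<eta>) a = vec_rmult \<xi> a + vec_rmult \<eta> a"
    by (simp add: vec_eq_iff distrib_right)
  then show ?case
    using tens assms(2,3) by (simp add: insert_vec_tens add_subgroup_add FM_subgroup
        F.one.tens_add_left vec_rmult_in)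
next
  case (add Y Z)
  then show ?case
    using assms(2,3) by (simp add: additive_onD[OF insert_vec_additive] add_subgroup_add
        FM_subgroup add_ac)
qed

lemma insert_vec_rmult:
  assumes "X \<in> B.E1" "\<xi> \<in> fst FM" "b \<in> Alg T'"
  shows "insert_vec (vec_rmult \<xi> b) X = insert_vec \<xi> (left_mult b X)"
  using assms(1)
proof (induction rule: B.one.tensor_induct)
  case (tens a \<omega>)
  have "vec_rmult (vec_rmult \<xi> b) a = vec_rmult \<xi> (b * a)"
    by (simp add: vec_eq_iff mult.assoc)
  then show ?case
    using tens assms(2,3) by (simp add: insert_vec_tens left_mult_tens vec_rmult_in S'.alg_mult)
next
  case (add Y Z)
  then show ?case
    using assms(2,3) by (simp add: additive_onD[OF insert_vec_additive]
        additive_onD[OF left_mult_additive] left_mult_in vec_rmult_in)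
qed

lemma
  shows change_base_in: "X \<in> F'.E1 \<Longrightarrow> change_base T T' \<Theta> X \<in> F.E1"
    and change_base_additive: "additive_on F'.E1 (change_base T T' \<Theta> :: _ \<Rightarrow> (('b ^ 'n) \<times> ('h \<Rightarrow>\<^sub>L 'h) \<Rightarrow>\<^sub>0 int) set)"
    and change_base_tens: "\<xi> \<in> fst FM \<Longrightarrow> \<omega> \<in> one_forms T' \<Longrightarrow>
      change_base T T' \<Theta> (F'.tens1 \<xi> \<omega>) = insert_vec \<xi> (Thi \<omega>)"
proof -
  let ?f = "\<lambda>\<xi> \<omega>. insert_vec \<xi> (Thi \<omega>)"
  have f: "?f \<xi> \<omega> \<in> F.E1" if "\<xi> \<in> fst FM" "\<omega> \<in> fst (one_forms_mod T')" for \<xi> \<omega>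
    using that by (simp add: insert_vec_in Thi_in)
  have bal: "balanced_map (Alg T') FM (one_forms_mod T') ?f"
    by (auto simp: balanced_map_def additive_on_def insert_vec_add insert_vec_rmult Thi_in Thi_add
        Thi_rep_left additive_onD[OF insert_vec_additive])
  have eq: "change_base T T' \<Theta> X = tensor_lift (Alg T') FM (one_forms_mod T') F.E1 ?f X" for X
    unfolding change_base_def Let_def insert_vec_def tensor_map_def Thi_def by simp
  note lift = tensor_lift_in[OF F'.one.tensor_pair_axioms F.one.tensor_pair_axioms f bal]
    tensor_lift_additive[OF F'.one.tensor_pair_axioms F.one.tensor_pair_axioms f bal]
    tensor_lift_tens[OF F'.one.tensor_pair_axioms F.one.tensor_pair_axioms f bal]
  show "X \<in> F'.E1 \<Longrightarrow> change_base T T' \<Theta> X \<in> F.E1"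
    "\<xi> \<in> fst FM \<Longrightarrow> \<omega> \<in> one_forms T' \<Longrightarrow>
      change_base T T' \<Theta> (F'.tens1 \<xi> \<omega>) = insert_vec \<xi> (Thi \<omega>)"
    unfolding eq by (use lift in auto)
  show "additive_on F'.E1 (change_base T T' \<Theta> :: _ \<Rightarrow> (('b ^ 'n) \<times> ('h \<Rightarrow>\<^sub>L 'h) \<Rightarrow>\<^sub>0 int) set)"
    using lift(2) by (simp add: additive_on_def eq)
qed

definition average_tensor where "average_tensor = tensor_map (Alg T) FM EM N1 avg"

lemmas average_tensor_additive =
  tensor_map_additive[OF F.one.tensor_pair_axioms E.one.tensor_pair_axioms hom_avg, folded average_tensor_def]
lemmas average_tensor_tens =
  tensor_map_tens[OF F.one.tensor_pair_axioms E.one.tensor_pair_axioms hom_avg, folded average_tensor_def, simplified]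

lemma average_tensor_insert_axis:
  assumes "Y \<in> B.E1" shows "average_tensor (insert_vec (axis i 1) Y) = embed N1 i Y"
  using assms
proof (induction rule: B.one.tensor_induct)
  case (tens a \<omega>)
  then show ?case
    by (simp add: insert_vec_tens axis_in S'.alg_one vec_rmult_axis average_tensor_tens embed1_tens)
next
  case (add Y Z)
  then show ?case
    by (simp add: additive_onD[OF insert_vec_additive] additive_onD[OF average_tensor_additive]
        additive_onD[OF embed1_additive] axis_in S'.alg_one insert_vec_in)
qed

section \<open>The connection and its Leibniz rule\<close>

abbreviation "nabla \<equiv> rep_connection G act T T' \<Theta> \<rho>"

text \<open>All stages of the definition are additive, so they act on the summands
  \<open>axis i 1 \<otimes> [D', \<xi>\<^sub>i]\<close> one by one, where their composite is
  \<open>embed\<close> after the inverse of \<open>\<Theta>\<close>. Tensor products with the free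
  module disappear from the formula.\<close>

lemma nabla_eq:
  assumes "\<xi> \<in> fst FM"
  shows "nabla \<xi> = (\<Sum>i\<in>UNIV. embed N1 i (Thi (dcomm T' (\<xi> $ i))))"
proof -
  have d: "dcomm T' (\<xi> $ i) \<in> one_forms T'" for i
    using assms by (simp add: fst_FM S'.one_form_dcomm)
  let ?X = "\<lambda>i. F'.tens1 (axis i 1) (dcomm T' (\<xi> $ i))"
  have X: "?X i \<in> F'.E1" for i by (intro F'.one.tens_in) (simp_all add: axis_in S'.alg_one d)
  have "nabla \<xi> = average_tensor (change_base T T' \<Theta> (\<Sum>i\<in>UNIV. ?X i))"
    by (simp add: rep_connection_def average_tensor_def tensor_map_def trivial_connection_def Let_def)
  also have "change_base T T' \<Theta> (\<Sum>i\<in>UNIV. ?X i) = (\<Sum>i\<in>UNIV. change_base T T' \<Theta> (?X i))"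
    using additive_on_sum[OF change_base_additive, of UNIV ?X] X by (simp add: F'.one.tensor_add)
  also have "average_tensor \<dots> = (\<Sum>i\<in>UNIV. average_tensor (change_base T T' \<Theta> (?X i)))"
    using additive_on_sum[OF average_tensor_additive, of UNIV "\<lambda>i. change_base T T' \<Theta> (?X i)"] X
    by (simp add: F.one.tensor_add change_base_in)
  finally show ?thesis
    by (simp add: change_base_tens axis_in S'.alg_one d average_tensor_insert_axis Thi_in)
qed

lemma fst_EM_D: "\<xi> \<in> fst EM \<Longrightarrow> \<xi> \<in> fst FM" "\<xi> \<in> fst EM \<Longrightarrow> \<xi> $ i \<in> Alg T'"
  by (simp_all add: fst_EM fst_FM)

lemma nabla_in: "\<xi> \<in> fst EM \<Longrightarrow> nabla \<xi> \<in> E.E1"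
  by (simp add: nabla_eq fst_EM_D)
    (intro E.one.tensor_sum, auto intro!: embed1_in Thi_in S'.one_form_dcomm fst_EM_D)

lemma embed_right_mult:
  assumes "Y \<in> B.E1" "x \<in> Alg T"
  shows "embed N1 i (right_mult T BM Y x) = right_mult T EM (embed N1 i Y) x"
  using assms(1)
proof (induction rule: B.one.tensor_induct)
  case (tens a \<omega>)
  then show ?case
    using assms(2) by (simp add: B.right_mult_tens E.right_mult_tens embed1_tens
        S.one_form_rep_right averaging_in axis_in)
next
  case (add Y Z)
  then show ?case
    using assms(2) by (simp add: additive_onD[OF B.right_mult_additive]
        additive_onD[OF E.right_mult_additive] additive_onD[OF embed1_additive] embed1_in
        B.right_mult_in)
qed

text \<open>Apply \<open>\<Theta>\<^sup>-\<^sup>1\<close> to \<open>[D', \<xi>\<^sub>i x] =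
  [D', \<xi>\<^sub>i] x + \<xi>\<^sub>i [D', x]\<close>. The last term comes from
  \<open>\<xi>\<^sub>i \<otimes> [D, x]\<close>; embedding and summing these gives
  \<open>e \<xi> \<otimes> [D, x]\<close>, and \<open>e \<xi> = \<xi>\<close> by invariance.\<close>

lemma nabla_leibniz:
  assumes \<xi>: "\<xi> \<in> fst EM" and x: "x \<in> Alg T"
  shows "nabla (vec_rmult \<xi> x) = right_mult T EM (nabla \<xi>) x + E.tens1 \<xi> (dcomm T x)"
proof -
  note \<xi>i = fst_EM_D(2)[OF \<xi>] and x' = alg'[OF x]
  have "Thi (dcomm T' (\<xi> $ i * x)) =
      right_mult T BM (Thi (dcomm T' (\<xi> $ i))) x + B.tens1 (\<xi> $ i) (dcomm T x)" for i
  proof (rule Thi_eqI)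
    have 1: "right_mult T BM (Thi (dcomm T' (\<xi> $ i))) x \<in> B.E1"
      using x \<xi>i by (simp add: B.right_mult_in Thi_in S'.one_form_dcomm)
    have 2: "B.tens1 (\<xi> $ i) (dcomm T x) \<in> B.E1"
      using x \<xi>i by (simp add: B.one.tens_in S.one_form_dcomm)
    show "right_mult T BM (Thi (dcomm T' (\<xi> $ i))) x + B.tens1 (\<xi> $ i) (dcomm T x) \<in> B.E1"
      by (rule B.one.tensor_add[OF 1 2])
    show "\<Theta> (right_mult T BM (Thi (dcomm T' (\<xi> $ i))) x + B.tens1 (\<xi> $ i) (dcomm T x)) =
        dcomm T' (\<xi> $ i * x)"
      using x x' \<xi>i by (simp add: Theta_add[OF 1 2] Theta_right_mult Thi_in S'.one_form_dcomm
          Theta_Thi Theta_dcomm S'.dcomm_mult)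
  qed
  then have "embed N1 i (Thi (dcomm T' (\<xi> $ i * x))) =
      right_mult T EM (embed N1 i (Thi (dcomm T' (\<xi> $ i)))) x +
      E.tens1 (avg (axis i (\<xi> $ i))) (dcomm T x)" for i
    using x \<xi>i by (simp add: additive_onD[OF embed1_additive] B.right_mult_in Thi_in
        S'.one_form_dcomm B.one.tens_in S.one_form_dcomm embed_right_mult embed1_tens)
  then have "nabla (vec_rmult \<xi> x) =
      (\<Sum>i\<in>UNIV. right_mult T EM (embed N1 i (Thi (dcomm T' (\<xi> $ i)))) x) +
      (\<Sum>i\<in>UNIV. E.tens1 (avg (axis i (\<xi> $ i))) (dcomm T x))"
    using \<xi> x' by (simp add: nabla_eq vec_rmult_in fst_EM_D sum.distrib)
  also have "(\<Sum>i\<in>UNIV. right_mult T EM (embed N1 i (Thi (dcomm T' (\<xi> $ i)))) x) =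
      right_mult T EM (nabla \<xi>) x"
    using additive_on_sum[OF E.right_mult_additive[OF x], of UNIV
        "\<lambda>i. embed N1 i (Thi (dcomm T' (\<xi> $ i)))"] \<xi> \<xi>i
    by (simp add: E.one.tensor_add embed1_in Thi_in S'.one_form_dcomm nabla_eq fst_EM_D)
  also have "(\<Sum>i\<in>UNIV. E.tens1 (avg (axis i (\<xi> $ i))) (dcomm T x)) = E.tens1 \<xi> (dcomm T x)"
    by (rule sum_tens_averaging_axis) (simp_all add: E.one.tensor_pair_axioms \<xi> x S.one_form_dcomm)
  finally show ?thesis .
qed

lemma nabla_connection: "is_connection T EM nabla"
proof -
  have add: "nabla (\<xi> + \<eta>) = nabla \<xi> + nabla \<eta>" if "\<xi> \<in> fst EM" "\<eta> \<in> fst EM" for \<xi> \<eta>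
    using that by (simp add: nabla_eq fst_EM_D add_subgroup_add FM_subgroup S'.dcomm_add Thi_add
        S'.one_form_dcomm additive_onD[OF embed1_additive] Thi_in sum.distrib)
  \<comment> \<open>Scalars have zero commutator with \<open>D\<close>, and
    \<open>\<xi> \<otimes> 0\<close> is the zero coset, so complex homogeneity is a case of the
    Leibniz rule.\<close>
  have "nabla (vec_rmult \<xi> (c *\<^sub>C 1)) = right_mult T EM (nabla \<xi>) (c *\<^sub>C 1)" if "\<xi> \<in> fst EM" for \<xi> c
    using that by (simp add: nabla_leibniz S.alg_scaleC S.alg_one S.dcomm_scaleC_one
        E.tens_one_zero E.one.tensor_add_rel E.right_mult_in nabla_in)
  with add show ?thesis
    by (auto simp: is_connection_def additive_on_def nabla_in nabla_leibniz)
qed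

end

section \<open>Equivariance and flatness\<close>

lemma cinner_add_left: "cinner (x + y) z = cinner x z + cinner y (z :: 'a::chilbert_space)"
  using cinner_commute[of "x + y" z] cinner_commute[of x z] cinner_commute[of y z]
  by (simp add: cinner_add_right)

locale equivariant_lift = covering_lift G act T \<rho> T' \<Theta>
  for G :: "'g monoid" (structure)
    and act :: "'g \<Rightarrow> 'b::cstar_algebra \<Rightarrow> 'b"
    and T :: "('b, 'h::chilbert_space) spectral_data"
    and \<rho> :: "'g \<Rightarrow> complex ^ 'n ^ 'n"
    and T' :: "('b, 'k::chilbert_space) spectral_data"
    and \<Theta> :: "('b \<times> ('h \<Rightarrow>\<^sub>L 'h) \<Rightarrow>\<^sub>0 int) set \<Rightarrow> ('k \<Rightarrow>\<^sub>L 'k)" +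
  fixes t :: "'b \<Rightarrow> 'h \<Rightarrow> 'k"
    and U :: "'g \<Rightarrow> 'k \<Rightarrow> 'k"
    and \<Theta>2 :: "('b \<times> ('h \<Rightarrow>\<^sub>L 'h) set \<Rightarrow>\<^sub>0 int) set \<Rightarrow> ('k \<Rightarrow>\<^sub>L 'k) set"
  assumes lifted: "lifted_space G act T t U"
    and lift: "is_lift G act T t U T'"
    and iso2: "two_forms_iso T T' \<Theta>2"
begin

text \<open>The lifted space is the algebraic tensor product itself, so every vector is a finite sum
  of values of \<open>t\<close> and additive identities can be checked without limits.\<close>

lemma lifted_induct:
  assumes "\<And>a x. P (t a x)" "\<And>y z. P y \<Longrightarrow> P z \<Longrightarrow> P (y + z)"
  shows "P y"
proof -
  let ?M = "(UNIV, (*)) :: ('b, 'b) rmod" and ?N = "(UNIV, \<lambda>a. blinfun_apply (Rep T a)) :: ('b, 'h) lmod"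
  let ?R = "closure (Alg T)"
  interpret L: tensor_pair ?R ?M ?N by unfold_locales (simp_all add: add_subgroup_def)
  obtain h where h: "bij_betw h (tensor ?R ?M ?N) UNIV" "additive_on (tensor ?R ?M ?N) h"
    "\<And>a x. h (tens ?R ?M ?N a x) = t a x"
    using lifted unfolding lifted_space_def Let_def by blast
  have "y \<in> h ` tensor ?R ?M ?N"
    using bij_betw_imp_surj_on[OF h(1)] by simp
  then obtain X where X: "X \<in> tensor ?R ?M ?N" "y = h X" by (elim imageE)
  from X(1) have "P (h X)"
  proof (induction rule: L.tensor_induct)
    case (tens a x)
    then show ?case by (simp add: h(3) assms(1))
  next
    case (add Y Z)
    then show ?case by (simp add: additive_onD[OF h(2)] assms(2))
  qed
  then show ?thesis by (simp add: X(2))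
qed

section \<open>The action of \<open>G\<close> on the lifted Hilbert space\<close>

lemma U_add: "g \<in> carrier G \<Longrightarrow> U g (y + z) = U g y + U g z"
  and U_t: "g \<in> carrier G \<Longrightarrow> U g (t a x) = t (act g a) x"
  and inner_t: "cinner (t a x) (t b x') =
        1 / of_nat (card (carrier G)) * cinner x (Rep T (hilbert_product G act a b) x')"
  using lifted by (simp_all add: lifted_space_def Let_def additive_on_def)

lemma rep_t: "Rep T' a (t b x) = t (a * b) x"
  using lift by (simp add: is_lift_def)

lemma U_dom: "g \<in> carrier G \<Longrightarrow> x \<in> Dom T' \<Longrightarrow> U g x \<in> Dom T'"
  and dirac_U: "g \<in> carrier G \<Longrightarrow> x \<in> Dom T' \<Longrightarrow> Dirac T' (U g x) = U g (Dirac T' x)"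
  using lift by (simp_all add: is_lift_def)

lemma U_diff: "g \<in> carrier G \<Longrightarrow> U g (y - z) = U g y - U g z"
  using U_add[of g "y - z" z] by (simp add: eq_diff_eq)

lemma U_mult: "g \<in> carrier G \<Longrightarrow> h \<in> carrier G \<Longrightarrow> U g (U h y) = U (g \<otimes> h) y"
  by (induction y rule: lifted_induct) (simp_all add: U_t U_add act_mult)

lemma U_one: "U \<one> y = y"
  by (induction y rule: lifted_induct) (simp_all add: U_t U_add act_one)

text \<open>The sum over the group absorbs \<open>g\<close> by a right translation, since
  \<open>act h\<close> is applied after \<open>act g\<close>. This makes \<open>U g\<close>
  isometric.\<close>

lemma hilbert_product_invariant:
  assumes "g \<in> carrier G"
  shows "hilbert_product G act (act g a) (act g b) = hilbert_product G act a b"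
proof -
  have "hilbert_product G act (act g a) (act g b) = (\<Sum>h\<in>carrier G. act (h \<otimes> g) (star a * b))"
    unfolding hilbert_product_def
    using assms by (intro sum.cong) (simp_all add: act_mult act_star act_times)
  also have "\<dots> = hilbert_product G act a b"
    unfolding hilbert_product_def by (rule sum_right_translate[OF assms])
  finally show ?thesis .
qed

text \<open>\<open>lifted_space\<close> states additivity of \<open>U g\<close> and its values on
  elementary tensors, but no continuity; the isometry property supplies it for the density argument
  in \<open>U_dcomm\<close>.\<close>

lemma U_inner:
  assumes g: "g \<in> carrier G" shows "cinner (U g y) (U g z) = cinner y z"
proof (induction y rule: lifted_induct)
  case (1 a x)
  show ?case
    by (induction z rule: lifted_induct)
      (simp_all add: g U_t U_add inner_t hilbert_product_invariant cinner_add_right)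
qed (simp add: U_add g cinner_add_left)

lemma U_norm: "g \<in> carrier G \<Longrightarrow> norm (U g y) = norm y"
proof -
  assume "g \<in> carrier G"
  then have "complex_of_real ((norm (U g y))\<^sup>2) = complex_of_real ((norm y)\<^sup>2)"
    by (simp add: cinner_norm[symmetric] U_inner del: of_real_power)
  then have "(norm (U g y))\<^sup>2 = (norm y)\<^sup>2" by (simp only: of_real_eq_iff)
  then show ?thesis by simp
qed

lemma U_continuous: "g \<in> carrier G \<Longrightarrow> continuous_on UNIV (U g)"
  unfolding continuous_on_iff by (auto simp: dist_norm U_diff[symmetric] U_norm)

lemma U_rep: "g \<in> carrier G \<Longrightarrow> U g (Rep T' a y) = Rep T' (act g a) (U g y)"
  by (induction y rule: lifted_induct) (simp_all add: rep_t U_t U_add act_times blinfun.add_right)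

text \<open>On the domain, \<open>U g\<close> commutes with \<open>D'\<close> and intertwines the
  representation. Both sides are continuous, so the identity spreads to the closure of the domain,
  which is the whole space.\<close>

lemma U_dcomm:
  assumes g: "g \<in> carrier G" and a: "a \<in> Alg T'"
  shows "U g (dcomm T' a y) = dcomm T' (act g a) (U g y)"
proof -
  have "U g (dcomm T' a y) = dcomm T' (act g a) (U g y)" if "y \<in> Dom T'" for y
    using g a that by (simp add: S'.dcomm_apply act_alg U_dom dirac_U U_diff S'.rep_dom
        U_rep[symmetric])
  then have "Dom T' \<subseteq> {y. U g (dcomm T' a y) = dcomm T' (act g a) (U g y)}" by blast
  moreover have "closed {y. U g (dcomm T' a y) = dcomm T' (act g a) (U g y)}"
  proof (rule closed_Collect_eq)
    show "continuous_on UNIV (\<lambda>y. U g (dcomm T' a y))"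
      by (rule continuous_on_compose2[OF U_continuous[OF g]]) (auto intro: continuous_intros)
    show "continuous_on UNIV (\<lambda>y. dcomm T' (act g a) (U g y))"
      by (intro continuous_intros U_continuous g)
  qed
  ultimately have "closure (Dom T') \<subseteq> {y. U g (dcomm T' a y) = dcomm T' (act g a) (U g y)}"
    by (rule closure_minimal)
  then show ?thesis using S'.dom_dense by auto
qed

lemma rep_sum':
  "(\<And>i. i \<in> I \<Longrightarrow> f i \<in> Alg T') \<Longrightarrow> Rep T' (sum f I) = (\<Sum>i\<in>I. Rep T' (f i))"
  by (induction I rule: infinite_finite_induct) (auto simp: S'.rep_zero S'.rep_add S'.alg_sum)

text \<open>Under \<open>\<Theta>\<close>, the operator \<open>g \<otimes> 1\<close> on \<open>\<A>' \<otimes> \<Omega>\<^sup>1(D)\<close> becomes conjugation by \<open>U g\<close>, because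
  \<open>[D', c]\<close> commutes with \<open>U g\<close> for \<open>c \<in> \<A>\<close>.\<close>

lemma Theta_coord_embed:
  assumes "Y \<in> B.E1"
  shows "\<Theta> (coord N1 i (embed N1 j Y)) x = (1 / real (card (carrier G))) *\<^sub>R
    (\<Sum>g\<in>carrier G. (\<rho> g $ i $ j) *\<^sub>C U g (\<Theta> Y (U (inv g) x)))"
  using assms
proof (induction rule: B.tensor_one_induct)
  case (dcomm a c)
  then have a: "a \<in> Alg T'" by simp
  have mem: "(\<rho> g $ i $ j) *\<^sub>C act g a \<in> Alg T'" if "g \<in> carrier G" for g
    using that a by (simp add: act_alg S'.alg_scaleC)
  have "U g (\<Theta> (B.tens1 a (dcomm T c)) (U (inv g) x)) = Rep T' (act g a) (dcomm T' c x)"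
    if g: "g \<in> carrier G" for g
  proof -
    have "act g c = c" using g dcomm(2) by (simp add: act_fixed act_fixed_alg)
    moreover have "U g (U (inv g) x) = x" using g by (simp add: U_mult U_one)
    ultimately show ?thesis
      using g dcomm a by (simp add: Theta_dcomm U_rep U_dcomm alg')
  qed
  \<comment> \<open>\<open>\<pi>\<^sub>i e \<iota>\<^sub>j\<close> acts on the left factor only, so
    the whole average ends up in the coefficient of \<open>[D', c]\<close>.\<close>
  moreover have "\<Theta> (coord N1 i (embed N1 j (B.tens1 a (dcomm T c)))) =
      Rep T' (avg (axis j a) $ i) o\<^sub>L dcomm T' c"
    using dcomm a by (simp add: embed1_tens coord1_tens S.one_form_dcomm averaging_in axis_in
        Theta_dcomm fst_EM_D(2)[OF averaging_in])
  moreover have "Rep T' (avg (axis j a) $ i) y = (1 / real (card (carrier G))) *\<^sub>R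
      (\<Sum>g\<in>carrier G. (\<rho> g $ i $ j) *\<^sub>C Rep T' (act g a) y)" for y
    using mem a by (simp add: averaging_axis_nth S'.rep_scaleR S'.alg_sum rep_sum' blinfun.scaleR_left
        blinfun.sum_left S'.rep_scaleC act_alg)
  ultimately show ?case by simp
next
  case (add Y Z)
  then show ?case
    by (simp add: additive_onD[OF embed1_additive] additive_onD[OF coord1_additive] embed1_in
        coord1_in Theta_add blinfun.add_left U_add scaleC_add_right sum.distrib scaleR_add_right)
qed

text \<open>Moving \<open>U g\<close> through the commutators turns the double sum into the average
  over \<open>g\<close> of \<open>[D', (g \<xi>)\<^sub>i]\<close>, and invariance of
  \<open>\<xi>\<close> makes all these terms equal to \<open>[D', \<xi>\<^sub>i]\<close>.\<close>

lemma Theta_coord_nabla: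
  assumes \<xi>: "\<xi> \<in> fst EM" shows "\<Theta> (coord N1 i (nabla \<xi>)) = dcomm T' (\<xi> $ i)"
proof (rule blinfun_eqI)
  fix x
  let ?n = "real (card (carrier G))"
  note \<xi>i = fst_EM_D(2)[OF \<xi>]
  let ?X = "\<lambda>j. embed N1 j (Thi (dcomm T' (\<xi> $ j)))"
  have X: "?X j \<in> E.E1" for j by (simp add: embed1_in Thi_in S'.one_form_dcomm \<xi>i)
  have "coord N1 i (nabla \<xi>) = (\<Sum>j\<in>UNIV. coord N1 i (?X j))"
    using additive_on_sum[OF coord1_additive, of UNIV ?X] X \<xi>
    by (simp add: nabla_eq fst_EM_D E.one.tensor_add)
  then have "\<Theta> (coord N1 i (nabla \<xi>)) = (\<Sum>j\<in>UNIV. \<Theta> (coord N1 i (?X j)))"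
    using additive_on_sum[OF Theta_additive, of UNIV "\<lambda>j. coord N1 i (?X j)"] X
    by (simp add: B.one.tensor_add coord1_in)
  then have "\<Theta> (coord N1 i (nabla \<xi>)) x = (\<Sum>j\<in>UNIV. (1 / ?n) *\<^sub>R
      (\<Sum>g\<in>carrier G. (\<rho> g $ i $ j) *\<^sub>C U g (dcomm T' (\<xi> $ j) (U (inv g) x))))"
    by (simp add: blinfun.sum_left Theta_coord_embed Thi_in S'.one_form_dcomm \<xi>i Theta_Thi)
  also have "\<dots> = (1 / ?n) *\<^sub>R (\<Sum>g\<in>carrier G. \<Sum>j\<in>UNIV.
      (\<rho> g $ i $ j) *\<^sub>C U g (dcomm T' (\<xi> $ j) (U (inv g) x)))"
    unfolding scaleR_sum_right[symmetric] by (subst sum.swap) (rule refl)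
  also have "(\<Sum>g\<in>carrier G. \<Sum>j\<in>UNIV.
      (\<rho> g $ i $ j) *\<^sub>C U g (dcomm T' (\<xi> $ j) (U (inv g) x))) = (\<Sum>g\<in>carrier G. dcomm T' (\<xi> $ i) x)"
  proof (rule sum.cong[OF refl])
    fix g assume g: "g \<in> carrier G"
    have "U g (U (inv g) x) = x" using g by (simp add: U_mult U_one)
    then have "(\<Sum>j\<in>UNIV. (\<rho> g $ i $ j) *\<^sub>C U g (dcomm T' (\<xi> $ j) (U (inv g) x))) =
        (\<Sum>j\<in>UNIV. dcomm T' ((\<rho> g $ i $ j) *\<^sub>C act g (\<xi> $ j)) x)"
      using g \<xi>i by (simp add: U_dcomm S'.dcomm_scaleC act_alg)
    also have "\<dots> = dcomm T' (tw g \<xi> $ i) x"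
      using g \<xi>i by (simp add: twisted_nth S'.dcomm_sum act_alg S'.alg_scaleC blinfun.sum_left)
    finally show "(\<Sum>j\<in>UNIV. (\<rho> g $ i $ j) *\<^sub>C U g (dcomm T' (\<xi> $ j) (U (inv g) x))) =
        dcomm T' (\<xi> $ i) x"
      using g \<xi> by (simp add: fst_EM)
  qed
  also have "(1 / ?n) *\<^sub>R \<dots> = dcomm T' (\<xi> $ i) x"
    using card_G_pos by (simp add: sum_constant_scaleR del: sum_constant)
  finally show "\<Theta> (coord N1 i (nabla \<xi>)) x = dcomm T' (\<xi> $ i) x" .
qed

section \<open>Degree two and the curvature\<close>

lemma Theta2_bij: "bij_betw \<Theta>2 B.E2 (two_forms T')"
  and Theta2_additive: "additive_on B.E2 \<Theta>2"
  using iso2 by (simp_all add: two_forms_iso_def Let_def)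

lemma Theta2_tens:
  assumes "a \<in> Alg T'" "c \<in> Alg T" "c' \<in> Alg T"
  shows "\<Theta>2 (B.tens2 a (wedge T (dcomm T c) (dcomm T c'))) =
    wedge T' (Rep T' a o\<^sub>L dcomm T' c) (dcomm T' c')"
proof -
  have "\<Theta>2 (B.tens2 a ((Rep T 1 o\<^sub>L dcomm T c o\<^sub>L dcomm T c') +o junk_two T)) =
      (Rep T' (a * 1) o\<^sub>L dcomm T' c o\<^sub>L dcomm T' c') +o junk_two T'"
    using iso2 assms S.alg_one unfolding two_forms_iso_def Let_def by blast
  then show ?thesis by (simp add: wedge_def S.rep_one)
qed

text \<open>The values are cosets of junk rather than elements of a tensor product, so
  \<open>additive_on_rel\<close> does not apply; an elementary tensor with left factor 0 yields the
  value instead.\<close>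

lemma Theta2_rel: "\<Theta>2 (tensor_rel (Alg T) BM N2) = junk_two T'"
proof -
  have "B.tens2 0 (wedge T (dcomm T 1) (dcomm T 1)) = tensor_rel (Alg T) BM N2"
    by (rule B.two.tens_zero_left) (simp add: S.wedge_in S.one_form_dcomm S.alg_one)
  then show ?thesis
    using Theta2_tens[OF S'.alg_zero S.alg_one S.alg_one] by (simp add: S'.rep_zero wedge_def)
qed

text \<open>On \<open>\<xi> \<otimes> [D, c]\<close> both sides are the class of
  \<open>\<xi>\<^sub>i [D', c] [D', b]\<close>. Exact right factors are enough, because tensors with
  exact forms generate \<open>E \<otimes> \<Omega>\<^sup>1(D)\<close>.\<close>

lemma Theta2_coord_right_wedge:
  assumes "X \<in> E.E1" "b \<in> Alg T"
  shows "\<Theta>2 (coord N2 i (right_wedge T EM X (dcomm T b))) =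
    wedge T' (\<Theta> (coord N1 i X)) (dcomm T' b)"
  using assms(1)
proof (induction rule: E.tensor_one_induct)
  case (dcomm \<xi> c)
  then show ?case
    using assms(2) by (simp add: E.right_wedge_tens coord2_tens coord1_tens S.one_form_dcomm
        S.wedge_in Theta2_tens Theta_dcomm fst_EM_D)
next
  case (add Y Z)
  then show ?case
    using assms(2) by (simp add: additive_onD[OF E.right_wedge_additive]
        additive_onD[OF coord2_additive] additive_onD[OF coord1_additive]
        additive_onD[OF Theta2_additive] Theta_add coord1_in coord2_in E.right_wedge_in
        S.one_form_dcomm S'.wedge_add_left)
qed

text \<open>On \<open>\<xi> \<otimes> [D, c]\<close> the term
  \<open>\<xi> \<otimes> d [D, c]\<close> vanishes, and \<open>\<nabla>(\<xi>) [D, c]\<close> goes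
  to \<open>[D', \<xi>\<^sub>i] [D', c]\<close>, which represents
  \<open>d (\<xi>\<^sub>i [D', c])\<close>. In coordinates the extended connection is thus the
  differential of the lifted triple.\<close>

lemma Theta2_coord_extend:
  assumes "X \<in> E.E1"
  shows "\<Theta>2 (coord N2 i (extend_connection T EM nabla X)) = d_one T' (\<Theta> (coord N1 i X))"
  using assms
proof (induction rule: E.tensor_one_induct)
  case (dcomm \<xi> c)
  note \<xi>i = fst_EM_D(2)[OF dcomm(1)]
  have J: "junk_two T \<in> two_forms T"
    using S.d_one_in[OF S.one_form_zero] by (simp add: junk_two_def)
  \<comment> \<open>The junk coset is the zero of the two-forms, so this tensor added to itself is
    unchanged and cancellation makes it zero.\<close>
  then have "E.tens2 \<xi> (junk_two T) = tensor_rel (Alg T) EM N2"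
    using E.two.tens_add_right[of \<xi> "junk_two T" "junk_two T"] dcomm(1)
    by (intro E.two.tensor_cancel[of "E.tens2 \<xi> (junk_two T)"])
      (simp_all add: E.two.tens_in subgroup_plus_self S.junk_subgroup)
  then have "E.tens2 \<xi> (d_one T (dcomm T c)) = tensor_rel (Alg T) EM N2"
    using dcomm by (simp add: S.d_one_dcomm)
  then have "extend_connection T EM nabla (E.tens1 \<xi> (dcomm T c)) =
      right_wedge T EM (nabla \<xi>) (dcomm T c)"
    using dcomm by (simp add: E.extend_connection_tens[OF nabla_connection] S.one_form_dcomm
        E.two.tensor_add_rel E.right_wedge_in nabla_in)
  then have "\<Theta>2 (coord N2 i (extend_connection T EM nabla (E.tens1 \<xi> (dcomm T c)))) =
      wedge T' (dcomm T' (\<xi> $ i)) (dcomm T' c)"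
    using dcomm by (simp add: Theta2_coord_right_wedge nabla_in Theta_coord_nabla)
  also have "\<dots> = d_one T' (Rep T' (\<xi> $ i) o\<^sub>L dcomm T' c)"
    using S'.d_one_coset[OF S'.d_one_gen[OF \<xi>i alg'[OF dcomm(2)]]] by (simp add: wedge_def)
  finally show ?case
    using dcomm \<xi>i by (simp add: coord1_tens S.one_form_dcomm Theta_dcomm)
next
  case (add Y Z)
  then show ?case
    by (simp add: additive_onD[OF E.extend_connection_additive[OF nabla_connection]]
        additive_onD[OF coord2_additive] additive_onD[OF coord1_additive]
        additive_onD[OF Theta2_additive] Theta_add coord1_in coord2_in
        E.extend_connection_in[OF nabla_connection] S'.d_one_add Theta_in)
qed

lemma nabla_flat: "is_flat T EM nabla"
  unfolding is_flat_def curvature_def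
proof
  fix \<xi> assume \<xi>: "\<xi> \<in> fst EM"
  let ?X = "extend_connection T EM nabla (nabla \<xi>)"
  have X: "?X \<in> E.E2" by (rule E.extend_connection_in[OF nabla_connection nabla_in[OF \<xi>]])
  \<comment> \<open>The image under \<open>\<Theta>2\<close> is
    \<open>d [D', \<xi>\<^sub>i]\<close>, the junk class; injectivity of \<open>\<Theta>2\<close>
    turns this into vanishing in \<open>\<A>' \<otimes> \<Omega>\<^sup>2(D)\<close>.\<close>
  have "coord N2 i ?X = tensor_rel (Alg T) BM N2" for i
  proof (rule inj_onD[OF bij_betw_imp_inj_on[OF Theta2_bij]])
    show "\<Theta>2 (coord N2 i ?X) = \<Theta>2 (tensor_rel (Alg T) BM N2)"
      using \<xi> by (simp add: Theta2_coord_extend nabla_in Theta_coord_nabla Theta2_rel fst_EM_D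
          S'.d_one_dcomm)
  qed (auto intro: coord2_in X B.two.rel_in)
  then show "?X = tensor_rel (Alg T) EM N2"
    by (intro tensor_eq_relI E.two.tensor_pair_axioms B.two.tensor_pair_axioms X)
qed

end

theorem mainTheorem1:
  fixes G :: "'g monoid"
    and act :: "'g \<Rightarrow> 'b::cstar_algebra \<Rightarrow> 'b"
    and T :: "('b, 'h::chilbert_space) spectral_data"
    and T' :: "('b, 'k::chilbert_space) spectral_data"
    and t :: "'b \<Rightarrow> 'h \<Rightarrow> 'k"
    and U :: "'g \<Rightarrow> 'k \<Rightarrow> 'k"
    and \<rho> :: "'g \<Rightarrow> complex ^ 'n ^ 'n"
  assumes "spectral_triple T"
    and "nc_covering (closure (Alg T)) G act"
    and "lifted_space G act T t U"
    and "is_lift G act T t U T'"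
    and "\<forall>g\<in>carrier G. act g ` Alg T' \<subseteq> Alg T'"
    and "Alg T \<subseteq> Alg T'"
    and "fg_projective (Alg T) (Alg T', (*))"
    and "one_forms_iso T T' \<Theta>"
    and "\<exists>\<Theta>2. two_forms_iso T T' \<Theta>2"
    and "linear_representation G \<rho>"
  shows "fg_projective (Alg T) (invariant_mod G act T' \<rho>) \<and>
    is_connection T (invariant_mod G act T' \<rho>) (rep_connection G act T T' \<Theta> \<rho>) \<and>
    is_flat T (invariant_mod G act T' \<rho>) (rep_connection G act T T' \<Theta> \<rho>)"
proof -
  obtain \<Theta>2 where \<Theta>2: "two_forms_iso T T' \<Theta>2" using assms(9) by blast
  have T': "spectral_triple T'" using assms(4) by (simp add: is_lift_def)
  interpret L: equivariant_lift G act T \<rho> T' \<Theta> t U \<Theta>2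
    by unfold_locales (use assms \<Theta>2 T' in auto)
  show ?thesis
    using L.fg_projective_EM[OF assms(7)] L.nabla_connection L.nabla_flat by blast
qed

end
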